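(* Let $\check\beta$ and $\check\Omega$ be a regular equivariant pair of estimators with exceptional set $N$, let $N^*$ and $T$ be the associated set and test statistic, and let $W(C)=\{y\in\mathbb{R}^n:T(y)\ge C\}$ with $0<C<\infty$. Suppose $\mathcal{Z}$ is a concentration space of the covariance model $\mathfrak{C}$. Then: 1. Suppose for some $\mu_0^*\in\mathfrak{M}_0$ the relations $z\in\mathbb{R}^n\setminus N^*$ and $T(\mu_0^*+z)>C$ hold simultaneously for $\lambda_{\mathcal{Z}}$-almost every $z$. Then $\sup_{\Sigma\in\mathfrak{C}}P_{\mu_0,\sigma^2\Sigma}(W(C))=1$ for every $\mu_0\in\mathfrak{M}_0$ and every $0<\sigma^2<\infty$. In particular, the size of the test equals one. 2. Suppose for some $\mu_0^*\in\mathfrak{M}_0$ the relations $z\in\mathbb{R}^n\setminus N^*$ and $T(\mu_0^*+z)<C$ hold simultaneously for $\lambda_{\mathcal{Z}}$-almost every $z$. Then $\inf_{\Sigma\in\mathfrak{C}}P_{\mu_0,\sigma^2\Sigma}(W(C))=0$ for every $\mu_0\in\mathfrak{M}_0$ and every $0<\sigma^2<\infty$, and hence $\inf_{\mu_1\in\mathfrak{M}_1}\inf_{\Sigma\in\mathfrak{C}}P_{\mu_1,\sigma^2\Sigma}(W(C))=0$ for every $0<\sigma^2<\infty$. In particular, the test is biased (except in the trivial case where its size is zero). Furthermore, for every $\mu_1\in\mathfrak{M}_1$, $\inf_{0<\sigma^2<\infty}\inf_{\Sigma\in\mathfrak{C}}P_{\mu_1,\sigma^2\Sigma}(W(C))=0$.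 In particular, the infimal power of the test equals zero. 3. Suppose $\check\Omega$ is nonnegative definite on $\mathbb{R}^n\setminus N$. If $z\in\mathbb{R}^n\setminus N$, $\check\Omega(z)=0$, and $R\check\beta(z)\ne0$ hold simultaneously for $\lambda_{\mathcal{Z}}$-almost every $z$, then $\sup_{\Sigma\in\mathfrak{C}}P_{\mu_0,\sigma^2\Sigma}(W(C))=1$ for every $\mu_0\in\mathfrak{M}_0$ and every $0<\sigma^2<\infty$. In particular, the size of the test equals one.
   Context: Framework: $n,k,q$ are integers with $1\le k<n$, $q\ge1$; $X$ is a fixed real $n\times k$ matrix of rank $k$; $R$ is a fixed real $q\times k$ matrix of rank $q$; $r\in\mathbb{R}^q$. $\mathfrak{C}$ (covariance model) is a nonempty set of symmetric positive definite $n\times n$ matrices such that $\sigma^2\in(0,\infty)$ and $\Sigma\in\mathfrak{C}$ are uniquely determined by $\sigma^2\Sigma$. $\mathfrak{M}=\operatorname{span}(X)$, $\mathfrak{M}_0=\{X\beta:\beta\in\mathbb{R}^k,\ R\beta=r\}$, $\mathfrak{M}_1=\mathfrak{M}\setminus\mathfrak{M}_0$. $P_{\mu,\Phi}$ is the Gaussian measure on $\mathbb{R}^n$ with mean $\mu$ and covariance matrix $\Phi$. The testing problem is $H_0:\mu\in\mathfrak{M}_0$ versus $H_1:\mu\in\mathfrak{M}_1$ (in both cases $0<\sigma^2<\infty$, $\Sigma\in\mathfrak{C}$ arbitrary), observation $\sim P_{\mu,\sigma^2\Sigma}$. For a rejection region $W$, size is the supremum of $P_{\mu,\sigma^2\Sigma}(W)$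 over $H_0$, infimal power the infimum over $H_1$; the test is biased if the infimal power is strictly smaller than the size. Concentration space: an $l$-dimensional linear subspace $\mathcal{Z}$ of $\mathbb{R}^n$, $0\le l<n$, such that there is a sequence $\Sigma_m\in\mathfrak{C}$ with $\Sigma_m\to\bar\Sigma$ and $\operatorname{span}(\bar\Sigma)=\mathcal{Z}$. $\lambda_{\mathcal{Z}}$ is Lebesgue measure on $\mathcal{Z}$ (point mass if $\dim\mathcal{Z}=0$). Regular equivariant pair with exceptional set $N$: (i) $\check\beta:\mathbb{R}^n\setminus N\to\mathbb{R}^k$ and $\check\Omega:\mathbb{R}^n\setminus N\to\mathbb{R}^{q\times q}$ are well-defined and continuous on the complement of a closed $\lambda_{\mathbb{R}^n}$-null set $N$, and $\check\Omega$ is symmetric there; (ii) $y\in\mathbb{R}^n\setminus N$ implies $\alpha y+X\gamma\in\mathbb{R}^n\setminus N$ for all $\alpha\ne0$, $\gamma\in\mathbb{R}^k$; (iii) $\check\beta(\alpha y+X\gamma)=\alpha\check\beta(y)+\gamma$ and $\check\Omega(\alpha y+X\gamma)=\alpha^2\check\Omega(y)$ for all $y\in\mathbb{R}^n\setminus N$, $\alpha\ne0$, $\gamma\in\mathbb{R}^k$; (iv) $\check\Omega$ is nonsingular $\lambda_{\mathbb{R}^n}$-almost everywhere on $\mathbb{R}^n\setminus N$. $N^*=N\cup\{y\in\mathbb{R}^n\setminus N:\det\check\Omega(y)=0\}$. $T(y)=(R\check\beta(y)-r)'\check\Omega^{-1}(y)(R\check\beta(y)-r)$ for $y\in\mathbb{R}^n\setminus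 N^*$, and $T(y)=0$ for $y\in N^*$. *)

theory Defs
  imports "HOL-Analysis.Analysis"
begin

definition symmetric_matrix :: "real^'n^'n \<Rightarrow> bool" where
  "symmetric_matrix A \<longleftrightarrow> transpose A = A"

definition pos_def :: "real^'n^'n \<Rightarrow> bool" where
  "pos_def A \<longleftrightarrow> (\<forall>x. x \<noteq> 0 \<longrightarrow> x \<bullet> (A *v x) > 0)"

definition nonneg_def :: "real^'n^'n \<Rightarrow> bool" where
  "nonneg_def A \<longleftrightarrow> (\<forall>x. x \<bullet> (A *v x) \<ge> 0)"

(* Given by the Lebesgue density, hence meaningful only for symmetric positive definite \<Phi>. *)
definition gaussian :: "real^'n \<Rightarrow> real^'n^'n \<Rightarrow> (real^'n) measure" where
  "gaussian \<mu> \<Phi> = density lborel (\<lambda>y. ennreal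
     (exp (- ((y - \<mu>) \<bullet> (matrix_inv \<Phi> *v (y - \<mu>))) / 2) / sqrt ((2 * pi) ^ CARD('n) * det \<Phi>)))"

definition covariance_model :: "(real^'n^'n) set \<Rightarrow> bool" where
  "covariance_model CC \<longleftrightarrow> CC \<noteq> {} \<and> (\<forall>S\<in>CC. symmetric_matrix S \<and> pos_def S) \<and>
     (\<forall>s>0. \<forall>s'>0. \<forall>S\<in>CC. \<forall>S'\<in>CC. s *\<^sub>R S = s' *\<^sub>R S' \<longrightarrow> s = s' \<and> S = S')"

definition regr_space :: "real^'k^'n \<Rightarrow> (real^'n) set" where
  "regr_space X = span (columns X)"

definition null_space :: "real^'k^'n \<Rightarrow> real^'k^'q \<Rightarrow> real^'q \<Rightarrow> (real^'n) set" where
  "null_space X R r = {X *v \<beta> | \<beta>. R *v \<beta> = r}"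

definition alt_space :: "real^'k^'n \<Rightarrow> real^'k^'q \<Rightarrow> real^'q \<Rightarrow> (real^'n) set" where
  "alt_space X R r = regr_space X - null_space X R r"

(* In the following three definitions s stands for the variance parameter \<sigma>\<^sup>2. *)
definition test_size :: "real^'k^'n \<Rightarrow> real^'k^'q \<Rightarrow> real^'q \<Rightarrow> (real^'n^'n) set \<Rightarrow> (real^'n) set \<Rightarrow> real" where
  "test_size X R r CC W =
     (SUP (\<mu>, s, S) \<in> null_space X R r \<times> {0<..} \<times> CC. measure (gaussian \<mu> (s *\<^sub>R S)) W)"

definition infimal_power :: "real^'k^'n \<Rightarrow> real^'k^'q \<Rightarrow> real^'q \<Rightarrow> (real^'n^'n) set \<Rightarrow> (real^'n) set \<Rightarrow> real" where
  "infimal_power X R r CC W =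
     (INF (\<mu>, s, S) \<in> alt_space X R r \<times> {0<..} \<times> CC. measure (gaussian \<mu> (s *\<^sub>R S)) W)"

definition biased_test :: "real^'k^'n \<Rightarrow> real^'k^'q \<Rightarrow> real^'q \<Rightarrow> (real^'n^'n) set \<Rightarrow> (real^'n) set \<Rightarrow> bool" where
  "biased_test X R r CC W \<longleftrightarrow> infimal_power X R r CC W < test_size X R r CC W"

definition concentration_space :: "(real^'n^'n) set \<Rightarrow> (real^'n) set \<Rightarrow> bool" where
  "concentration_space CC Z \<longleftrightarrow> subspace Z \<and> dim Z < CARD('n) \<and>
     (\<exists>S Sbar. (\<forall>m::nat. S m \<in> CC) \<and> S \<longlonglongrightarrow> Sbar \<and> span (columns Sbar) = Z)"

definition is_onb :: "'a::euclidean_space set \<Rightarrow> 'a set \<Rightarrow> bool" where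
  "is_onb Z B \<longleftrightarrow> pairwise orthogonal B \<and> (\<forall>b\<in>B. norm b = 1) \<and> span B = Z"

lemma is_onb_exists:
  assumes "subspace Z"
  shows "\<exists>B. is_onb Z B"
  using orthonormal_basis_subspace[OF assms] unfolding is_onb_def by metis

(* Lebesgue measure on the subspace Z, transported from coordinates with respect to an orthonormal
   basis of Z. The choice of basis is immaterial because Lebesgue measure is invariant under
   orthogonal maps. *)
definition lebesgue_on_subspace :: "'a::euclidean_space set \<Rightarrow> 'a measure" where
  "lebesgue_on_subspace Z = (let B = (SOME B. is_onb Z B) in
     distr (PiM B (\<lambda>_. lborel)) borel (\<lambda>c. \<Sum>b\<in>B. c b *\<^sub>R b))"

lemma emeasure_lebesgue_on_subspace_zero:
  fixes A :: "'a::euclidean_space set"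
  assumes "A \<in> sets borel"
  shows "emeasure (lebesgue_on_subspace {0}) A = indicator A 0"
proof -
  define B where "B = (SOME B. is_onb ({0} :: 'a set) B)"
  have "is_onb {0} B"
    unfolding B_def by (rule someI_ex) (rule is_onb_exists, simp)
  then have "B = {}"
    unfolding is_onb_def by (metis ex_in_conv norm_zero singletonD span_base zero_neq_one)
  then show ?thesis
    using assms unfolding lebesgue_on_subspace_def B_def[symmetric]
    by (auto simp: emeasure_distr PiM_empty indicator_def emeasure_count_space)
qed

(* The estimators are partial maps on the complement of N; their values on N are irrelevant. *)
definition regular_equivariant_pair ::
  "real^'k^'n \<Rightarrow> (real^'n \<Rightarrow> real^'k) \<Rightarrow> (real^'n \<Rightarrow> real^'q^'q) \<Rightarrow> (real^'n) set \<Rightarrow> bool" where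
  "regular_equivariant_pair X b \<Omega> N \<longleftrightarrow>
     closed N \<and> N \<in> null_sets lborel \<and>
     continuous_on (- N) b \<and> continuous_on (- N) \<Omega> \<and>
     (\<forall>y. y \<notin> N \<longrightarrow> symmetric_matrix (\<Omega> y)) \<and>
     (\<forall>y \<alpha> \<gamma>. y \<notin> N \<longrightarrow> \<alpha> \<noteq> 0 \<longrightarrow> \<alpha> *\<^sub>R y + X *v \<gamma> \<notin> N) \<and>
     (\<forall>y \<alpha> \<gamma>. y \<notin> N \<longrightarrow> \<alpha> \<noteq> 0 \<longrightarrow>
        b (\<alpha> *\<^sub>R y + X *v \<gamma>) = \<alpha> *\<^sub>R b y + \<gamma> \<and>
        \<Omega> (\<alpha> *\<^sub>R y + X *v \<gamma>) = \<alpha>\<^sup>2 *\<^sub>R \<Omega> y) \<and>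
     (AE y in lborel. y \<notin> N \<longrightarrow> invertible (\<Omega> y))"

definition N_star :: "(real^'n \<Rightarrow> real^'q^'q) \<Rightarrow> (real^'n) set \<Rightarrow> (real^'n) set" where
  "N_star \<Omega> N = N \<union> {y. y \<notin> N \<and> det (\<Omega> y) = 0}"

definition test_stat :: "real^'k^'q \<Rightarrow> real^'q \<Rightarrow> (real^'n \<Rightarrow> real^'k) \<Rightarrow>
    (real^'n \<Rightarrow> real^'q^'q) \<Rightarrow> (real^'n) set \<Rightarrow> real^'n \<Rightarrow> real" where
  "test_stat R r b \<Omega> N y =
     (if y \<in> N_star \<Omega> N then 0
      else (R *v b y - r) \<bullet> (matrix_inv (\<Omega> y) *v (R *v b y - r)))"

definition rejection_region :: "real^'k^'q \<Rightarrow> real^'q \<Rightarrow> (real^'n \<Rightarrow> real^'k) \<Rightarrow>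
    (real^'n \<Rightarrow> real^'q^'q) \<Rightarrow> (real^'n) set \<Rightarrow> real \<Rightarrow> (real^'n) set" where
  "rejection_region R r b \<Omega> N C = {y. test_stat R r b \<Omega> N y \<ge> C}"

end

theory Submission
  imports Defs "HOL-Probability.Probability"
begin

text \<open>
  Write \<open>T\<^sub>0(y)\<close> for the test statistic with \<open>r = 0\<close>. Equivariance of the pair of estimators gives
  \<open>T(X\<beta> + c y) = T\<^sub>0(y)\<close> whenever \<open>R\<beta> = r\<close> and \<open>c \<noteq> 0\<close>, so that the rejection probability
  under mean \<open>X(\<beta> + \<delta>)\<close> and covariance \<open>s\<Sigma>\<close> is the probability of the single region
  \<open>W\<^sub>0 = {T\<^sub>0 \<ge> C}\<close> under mean \<open>X\<delta>/\<surd>s\<close> and covariance \<open>\<Sigma>\<close> (lemma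
  \<open>measure_rejection_region\<close>). All the claims therefore concern the behaviour of Gaussian
  probabilities of \<open>W\<^sub>0\<close> when the mean tends to \<open>0\<close> and the covariance runs through the model.

  Let \<open>\<Sigma>\<^sub>m\<close> converge to a matrix with column space \<open>Z\<close>. Factorize \<open>\<Sigma>\<^sub>m = A\<^sub>m A\<^sub>m'\<close>; the \<open>A\<^sub>m\<close> are
  bounded, so along a subsequence they converge to some \<open>K\<close> whose range is \<open>Z\<close>
  (\<open>convergent_factorization\<close>). If \<open>g\<close> is standard Gaussian and \<open>x\<^sub>m\<close> tends to \<open>0\<close>, then
  \<open>x\<^sub>m + A\<^sub>m g\<close> has the law with mean \<open>x\<^sub>m\<close> and covariance \<open>\<Sigma>\<^sub>m\<close>
  (\<open>gaussian_eq_distr_std_gaussian\<close>) and converges pointwise to \<open>K g\<close>. The map \<open>g \<mapsto> K g\<close> pulls null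
  sets of Lebesgue measure on \<open>Z\<close> back to null sets (\<open>AE_lebesgue_on_subspace_pullback\<close>).
  Hence, if almost every point of \<open>Z\<close> is interior to a region \<open>V\<close>, then almost surely
  \<open>x\<^sub>m + A\<^sub>m g\<close> eventually lies in \<open>V\<close>, and by dominated convergence the probabilities of \<open>V\<close>
  tend to one (\<open>gaussian_concentration\<close>).

  It remains to name the regions. Since \<open>T\<^sub>0\<close> is continuous on the open complement of \<open>N\<^sup>*\<close>, points
  where \<open>T\<^sub>0 > C\<close> are interior to \<open>W\<^sub>0\<close>, and points where \<open>T\<^sub>0 < C\<close> are interior to its complement; this
  yields size one and vanishing power, respectively, the latter by choosing \<open>\<delta> \<rightarrow> 0\<close> or
  \<open>s \<rightarrow> \<infinity>\<close>. At a point where the covariance estimator vanishes but \<open>R\<close> applied to the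
  estimated coefficient does not, \<open>T\<^sub>0\<close> tends to infinity off \<open>N\<^sup>*\<close>, so such a point is interior to
  \<open>W\<^sub>0 \<union> N\<^sup>*\<close>, a region with the same Gaussian probabilities because \<open>N\<^sup>*\<close> is Lebesgue null.
\<close>

section \<open>Linear change of variables for Lebesgue measure\<close>

lemma linear_borel_measurable:
  fixes f :: "'a::euclidean_space \<Rightarrow> 'b::euclidean_space"
  shows "linear f \<Longrightarrow> f \<in> borel_measurable borel"
  by (auto intro!: borel_measurable_continuous_onI linear_continuous_on linear_conv_bounded_linear[THEN iffD1])

lemma borel_measurable_affine_matrix [measurable]:
  fixes A :: "real^'n^'m"
  shows "(\<lambda>x. v + A *v x) \<in> borel_measurable borel"
  by (intro borel_measurable_continuous_onI continuous_intros)

lemma nn_integral_lborel_translate: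
  fixes f :: "'a::euclidean_space \<Rightarrow> ennreal"
  assumes [measurable]: "f \<in> borel_measurable borel"
  shows "(\<integral>\<^sup>+x. f (a + x) \<partial>lborel) = (\<integral>\<^sup>+x. f x \<partial>lborel)"
  by (subst (2) lborel_distr_plus[of a, symmetric]) (simp add: nn_integral_distr)

text \<open>
  A shear along \<open>e\<close> moves each line \<open>x + \<real> e\<close> into itself by a translation, hence preserves the
  integral along it. Instead of splitting off a coordinate, the proof disintegrates along these
  lines with the weight \<open>h \<circ> p\<close>, where \<open>h\<close> has integral one and \<open>p\<close> parametrizes the lines.
\<close>
lemma nn_integral_lborel_shear:
  fixes f :: "'a::euclidean_space \<Rightarrow> ennreal" and e :: 'a and p q :: "'a \<Rightarrow> real"
  assumes [measurable]: "f \<in> borel_measurable borel"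
    and p: "linear p" "p e = 1" and q: "linear q" "q e = 0"
  shows "(\<integral>\<^sup>+x. f (x + q x *\<^sub>R e) \<partial>lborel) = (\<integral>\<^sup>+x. f x \<partial>lborel)"
proof -
  have [measurable]: "p \<in> borel_measurable borel" "q \<in> borel_measurable borel"
    using p(1) q(1) by (simp_all add: linear_borel_measurable)
  define h :: "real \<Rightarrow> ennreal" where "h = indicator {0..1}"
  have [measurable]: "h \<in> borel_measurable borel" by (simp add: h_def)
  have h1: "(\<integral>\<^sup>+t. h (t + c) \<partial>lborel) = 1" for c
    using nn_integral_lborel_translate[of h c] by (simp add: h_def add.commute)
  \<comment> \<open>The right-hand side is free of the displacement \<open>k\<close>; comparing \<open>k = q\<close> with \<open>k = 0\<close> gives the claim.\<close>
  have orbit: "(\<integral>\<^sup>+x. f (x + k x *\<^sub>R e) \<partial>lborel)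
      = (\<integral>\<^sup>+x. h (p x) * (\<integral>\<^sup>+t. f (x - t *\<^sub>R e) \<partial>lborel) \<partial>lborel)"
    if [measurable]: "k \<in> borel_measurable borel" and k: "\<And>x t. k (x + t *\<^sub>R e) = k x" for k :: "'a \<Rightarrow> real"
  proof -
    have "(\<integral>\<^sup>+x. f (x + k x *\<^sub>R e) \<partial>lborel)
        = (\<integral>\<^sup>+x. (\<integral>\<^sup>+t. f (x + k x *\<^sub>R e) * h (t + p x) \<partial>lborel) \<partial>lborel)"
      by (simp add: nn_integral_cmult h1)
    also have "\<dots> = (\<integral>\<^sup>+t. (\<integral>\<^sup>+x. f (x + k x *\<^sub>R e) * h (t + p x) \<partial>lborel) \<partial>lborel)"
      by (rule lborel_pair.Fubini') measurable
    also have "\<dots> = (\<integral>\<^sup>+t. (\<integral>\<^sup>+x. f (x + (k x - t) *\<^sub>R e) * h (p x) \<partial>lborel) \<partial>lborel)"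
    proof (rule nn_integral_cong)
      fix t :: real
      have "p (- t *\<^sub>R e + x) = p x - t" "k (- t *\<^sub>R e + x) = k x" for x
        using p k[of x "-t"] by (simp_all add: linear_add linear_scale linear_diff)
      then show "(\<integral>\<^sup>+x. f (x + k x *\<^sub>R e) * h (t + p x) \<partial>lborel)
          = (\<integral>\<^sup>+x. f (x + (k x - t) *\<^sub>R e) * h (p x) \<partial>lborel)"
        by (subst nn_integral_lborel_translate[of _ "- t *\<^sub>R e", symmetric]) (auto simp: algebra_simps)
    qed
    also have "\<dots> = (\<integral>\<^sup>+x. (\<integral>\<^sup>+t. f (x + (k x - t) *\<^sub>R e) * h (p x) \<partial>lborel) \<partial>lborel)"
      by (rule lborel_pair.Fubini'[symmetric]) measurable
    also have "\<dots> = (\<integral>\<^sup>+x. h (p x) * (\<integral>\<^sup>+t. f (x - t *\<^sub>R e) \<partial>lborel) \<partial>lborel)"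
    proof (rule nn_integral_cong)
      fix x
      show "(\<integral>\<^sup>+t. f (x + (k x - t) *\<^sub>R e) * h (p x) \<partial>lborel) = h (p x) * (\<integral>\<^sup>+t. f (x - t *\<^sub>R e) \<partial>lborel)"
        by (subst nn_integral_lborel_translate[of _ "k x", symmetric])
           (auto simp: nn_integral_cmult mult.commute)
    qed
    finally show ?thesis .
  qed
  have "q (x + t *\<^sub>R e) = q x" for x t
    using q by (simp add: linear_add linear_scale)
  then show ?thesis
    using orbit[of q] orbit[of "\<lambda>_. 0"] by simp
qed

lemma nn_integral_lborel_stretch:
  fixes f :: "real^'n \<Rightarrow> ennreal" and c :: "'n \<Rightarrow> real"
  assumes [measurable]: "f \<in> borel_measurable borel" and c: "\<And>i. c i \<noteq> 0"
  shows "(\<integral>\<^sup>+y. f y \<partial>lborel) = ennreal (\<Prod>i\<in>UNIV. \<bar>c i\<bar>) * (\<integral>\<^sup>+x. f (\<chi> i. c i * x $ i) \<partial>lborel)"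
proof -
  define d where "d b = (\<chi> i. c i) \<bullet> b" for b :: "real^'n"
  have B: "(Basis :: (real^'n) set) = range (\<lambda>i. axis i 1)" and inj: "inj (\<lambda>i::'n. axis i (1::real))"
    by (auto simp: Basis_vec_def inj_on_def axis_eq_axis)
  have d0: "d b \<noteq> 0" if "b \<in> Basis" for b
    using that c by (auto simp: B d_def inner_axis)
  have T: "0 + (\<Sum>j\<in>Basis. (d j * (x \<bullet> j)) *\<^sub>R j) = (\<chi> i. c i * x $ i)" for x
  proof -
    have "(\<Sum>j\<in>Basis. (d j * (x \<bullet> j)) *\<^sub>R j) = (\<Sum>i\<in>UNIV. (c i * x $ i) *\<^sub>R axis i 1)"
      by (simp add: B sum.reindex[OF inj] d_def inner_axis)
    also have "\<dots> = (\<chi> i. c i * x $ i)"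
      by (simp add: vec_eq_iff axis_def if_distrib sum.delta cong: if_cong)
    finally show ?thesis by simp
  qed
  have P: "(\<Prod>j\<in>Basis. \<bar>d j\<bar>) = (\<Prod>i\<in>UNIV. \<bar>c i\<bar>)"
    by (simp add: B prod.reindex[OF inj] d_def inner_axis)
  have [measurable]: "(\<lambda>x::real^'n. \<chi> i. c i * x $ i) \<in> borel_measurable borel"
    by (rule linear_borel_measurable) (auto intro!: linearI simp: vec_eq_iff algebra_simps)
  have "lborel = density (distr lborel borel (\<lambda>x. \<chi> i. c i * x $ i)) (\<lambda>_. ennreal (\<Prod>i\<in>UNIV. \<bar>c i\<bar>))"
    using lborel_affine_euclidean[of d 0, OF d0] unfolding T P by simp
  then have "(\<integral>\<^sup>+y. f y \<partial>lborel)
      = (\<integral>\<^sup>+y. f y \<partial>density (distr lborel borel (\<lambda>x. \<chi> i. c i * x $ i)) (\<lambda>_. ennreal (\<Prod>i\<in>UNIV. \<bar>c i\<bar>)))"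
    by (rule arg_cong)
  then show ?thesis
    by (simp add: nn_integral_density nn_integral_distr nn_integral_cmult)
qed

lemma nn_integral_lborel_swap:
  fixes f :: "real^'n \<Rightarrow> ennreal"
  assumes [measurable]: "f \<in> borel_measurable borel"
  shows "(\<integral>\<^sup>+x. f (\<chi> i. x $ Transposition.transpose m n i) \<partial>lborel) = (\<integral>\<^sup>+y. f y \<partial>lborel)"
proof -
  let ?h = "\<lambda>x::real^'n. \<chi> i. x $ Transposition.transpose m n i"
  have [measurable]: "?h \<in> borel_measurable borel"
    by (rule linear_borel_measurable) (auto intro!: linearI simp: vec_eq_iff)
  have B: "(Basis :: (real^'n) set) = range (\<lambda>i. axis i 1)" and inj: "inj (\<lambda>i::'n. axis i (1::real))"
    by (auto simp: Basis_vec_def inj_on_def axis_eq_axis)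
  have "lborel = distr lborel borel ?h"
  proof (rule lborel_eqI)
    fix l u :: "real^'n" assume le: "\<And>b. b \<in> Basis \<Longrightarrow> l \<bullet> b \<le> u \<bullet> b"
    have le': "l $ i \<le> u $ i" for i
      using le[of "axis i 1"] by (auto simp: B inner_axis)
    have "?h -` box l u = box (?h l) (?h u)"
      by (auto simp: mem_box_cart) (metis transpose_involutory)+
    then have "emeasure (distr lborel borel ?h) (box l u) = emeasure lborel (box (?h l) (?h u))"
      by (simp add: emeasure_distr)
    also have "\<dots> = (\<Prod>b\<in>Basis. (?h u - ?h l) \<bullet> b)"
      by (intro emeasure_lborel_box) (auto simp: B inner_axis le')
    also have "(\<Prod>b\<in>Basis. (?h u - ?h l) \<bullet> b) = (\<Prod>i\<in>UNIV. (u - l) $ Transposition.transpose m n i)"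
      by (simp add: B prod.reindex[OF inj] inner_axis)
    also have "\<dots> = (\<Prod>i\<in>UNIV. (u - l) $ i)"
      by (rule prod.permute[OF permutes_swap_id, where g="\<lambda>i. (u - l) $ i", symmetric, unfolded o_def]) auto
    also have "\<dots> = (\<Prod>b\<in>Basis. (u - l) \<bullet> b)"
      by (simp add: B prod.reindex[OF inj] inner_axis)
    finally show "emeasure (distr lborel borel ?h) (box l u) = (\<Prod>b\<in>Basis. (u - l) \<bullet> b)" .
  qed simp
  then have "(\<integral>\<^sup>+y. f y \<partial>lborel) = (\<integral>\<^sup>+y. f y \<partial>distr lborel borel ?h)"
    by (rule arg_cong)
  then show ?thesis
    by (simp add: nn_integral_distr)
qed

text \<open>
  The formula is multiplicative in \<open>T\<close>, so it suffices to treat the generators of the linear maps: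
  coordinate stretchings, transpositions and shears. Singular maps satisfy the claim vacuously.
\<close>
theorem nn_integral_lborel_linear:
  fixes f :: "real^'n \<Rightarrow> ennreal" and T :: "real^'n \<Rightarrow> real^'n"
  assumes "linear T" "det (matrix T) \<noteq> 0" "f \<in> borel_measurable borel"
  shows "(\<integral>\<^sup>+y. f y \<partial>lborel) = ennreal \<bar>det (matrix T)\<bar> * (\<integral>\<^sup>+x. f (T x) \<partial>lborel)"
proof -
  let ?P = "\<lambda>T. det (matrix T) \<noteq> 0 \<longrightarrow> (\<forall>f \<in> borel_measurable borel.
      (\<integral>\<^sup>+y. f y \<partial>lborel) = ennreal \<bar>det (matrix T)\<bar> * (\<integral>\<^sup>+x. f (T x) \<partial>(lborel :: (real^'n) measure)))"
  have "?P T"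
  proof (rule induct_linear_elementary[OF \<open>linear T\<close>])
    fix S T :: "real^'n \<Rightarrow> real^'n"
    assume lin: "linear S" "linear T" and S: "?P S" and T: "?P T"
    have [measurable]: "S \<in> borel_measurable borel" "T \<in> borel_measurable borel"
      by (rule linear_borel_measurable, fact)+
    have D: "det (matrix (S \<circ> T)) = det (matrix S) * det (matrix T)"
      using lin by (simp add: matrix_compose det_mul)
    show "?P (S \<circ> T)"
    proof (intro impI ballI)
      fix f :: "real^'n \<Rightarrow> ennreal" assume [measurable]: "f \<in> borel_measurable borel"
      assume "det (matrix (S \<circ> T)) \<noteq> 0"
      then have nz: "det (matrix S) \<noteq> 0" "det (matrix T) \<noteq> 0" by (simp_all add: D)
      have "(\<integral>\<^sup>+y. f y \<partial>lborel) = ennreal \<bar>det (matrix S)\<bar> * (\<integral>\<^sup>+x. f (S x) \<partial>lborel)"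
        by (rule mp[OF S, THEN bspec]) (use nz in simp_all)
      also have "(\<integral>\<^sup>+x. f (S x) \<partial>lborel) = ennreal \<bar>det (matrix T)\<bar> * (\<integral>\<^sup>+x. f (S (T x)) \<partial>lborel)"
        by (rule mp[OF T, THEN bspec]) (use nz in simp_all)
      finally show "(\<integral>\<^sup>+y. f y \<partial>lborel)
          = ennreal \<bar>det (matrix (S \<circ> T))\<bar> * (\<integral>\<^sup>+x. f ((S \<circ> T) x) \<partial>lborel)"
        by (simp add: D abs_mult ennreal_mult mult.assoc)
    qed
  next
    fix T :: "real^'n \<Rightarrow> real^'n" and i assume "linear T" and 0: "\<And>x. T x $ i = 0"
    then have "\<not> inj T"
      by (metis (full_types) linear_injective_imp_surjective one_neq_zero surjE vec_component)
    then show "?P T"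
      using det_nz_iff_inj[OF \<open>linear T\<close>] by blast
  next
    fix c :: "'n \<Rightarrow> real"
    have "matrix (\<lambda>x. \<chi> i. c i * x $ i) = (\<chi> i j. if i = j then c i else 0)"
      by (simp add: matrix_def axis_def vec_eq_iff)
    then have "det (matrix (\<lambda>x. \<chi> i. c i * x $ i)) = (\<Prod>i\<in>UNIV. c i)"
      by (simp add: det_diagonal)
    then show "?P (\<lambda>x. \<chi> i. c i * x $ i)"
      by (auto simp: abs_prod intro!: nn_integral_lborel_stretch)
  next
    fix m n :: 'n assume "m \<noteq> n"
    let ?h = "\<lambda>v::real^'n. \<chi> i. v $ Transposition.transpose m n i"
    have "(\<chi> i j. if Transposition.transpose m n i = j then 1 else 0) = (\<chi> i j. if j = Transposition.transpose m n i then 1 else (0::real))"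
      by (auto intro!: Cart_lambda_cong)
    then have "matrix ?h = transpose(\<chi> i j. mat 1 $ i $ Transposition.transpose m n j)"
      by (auto simp: matrix_eq transpose_def axis_def mat_def matrix_def)
    then have "\<bar>det (matrix ?h)\<bar> = 1"
      by (simp add: det_permute_columns permutes_swap_id sign_swap_id abs_mult)
    then show "?P ?h"
      by (simp add: nn_integral_lborel_swap)
  next
    fix m n :: 'n assume "m \<noteq> n"
    let ?h = "\<lambda>x::real^'n. \<chi> i. if i = m then x $ m + x $ n else x $ i"
    have "matrix ?h = (\<chi> k. if k = m then row m (mat 1) + 1 *s row n (mat 1) else row k (mat 1))"
      using \<open>m \<noteq> n\<close> by (auto simp: matrix_def axis_def vec_eq_iff row_def mat_def)
    then have "det (matrix ?h) = 1"
      using \<open>m \<noteq> n\<close> by (simp add: det_row_operation)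
    moreover have "?h x = x + (x $ n) *\<^sub>R axis m 1" for x
      by (simp add: vec_eq_iff axis_def)
    moreover have "(\<integral>\<^sup>+x. f (x + (x $ n) *\<^sub>R axis m 1) \<partial>lborel) = (\<integral>\<^sup>+x. f x \<partial>lborel)"
      if "f \<in> borel_measurable borel" for f :: "real^'n \<Rightarrow> ennreal"
      using \<open>m \<noteq> n\<close> by (intro nn_integral_lborel_shear[where p="\<lambda>x. x $ m"] that linearI) (auto simp: axis_def)
    ultimately show "?P ?h"
      by simp
  qed
  then show ?thesis
    by (rule mp[THEN bspec]) (use assms in simp_all)
qed

corollary nn_integral_lborel_affine:
  fixes f :: "real^'n \<Rightarrow> ennreal" and A :: "real^'n^'n"
  assumes "det A \<noteq> 0" and [measurable]: "f \<in> borel_measurable borel"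
  shows "(\<integral>\<^sup>+y. f y \<partial>lborel) = ennreal \<bar>det A\<bar> * (\<integral>\<^sup>+x. f (\<mu> + A *v x) \<partial>lborel)"
  proof -
  have "(\<integral>\<^sup>+y. f y \<partial>lborel) = (\<integral>\<^sup>+y. f (\<mu> + y) \<partial>lborel)"
    by (simp add: nn_integral_lborel_translate)
  also have "\<dots> = ennreal \<bar>det A\<bar> * (\<integral>\<^sup>+x. f (\<mu> + A *v x) \<partial>lborel)"
    using nn_integral_lborel_linear[of "(*v) A" "\<lambda>x. f (\<mu> + x)"] assms(1) by simp
  finally show ?thesis .
qed

section \<open>Gaussian measures as affine images of the standard Gaussian\<close>

lemma matrix_inv_eqI:
  fixes A :: "real^'n^'n"
  assumes "A ** B = mat 1"
  shows "matrix_inv A = B"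
proof -
  have "invertible A" using assms invertible_right_inverse by blast
  then have "matrix_inv A ** A = mat 1"
    unfolding matrix_inv_def invertible_def by (metis (mono_tags, lifting) someI_ex)
  then show ?thesis
    by (metis assms matrix_mul_assoc matrix_mul_lid matrix_mul_rid)
qed

lemma matrix_inv_right:
  fixes M :: "real^'n^'n"
  assumes "det M \<noteq> 0"
  shows "M ** matrix_inv M = mat 1"
  using assms matrix_inv_eqI[of M] unfolding invertible_det_nz[symmetric] invertible_def by metis

lemma sets_gaussian [simp, measurable_cong]: "sets (gaussian \<mu> \<Phi>) = sets borel"
  and space_gaussian [simp]: "space (gaussian \<mu> \<Phi>) = UNIV"
  by (simp_all add: gaussian_def)

abbreviation std_gaussian :: "(real^'n) measure" where
  "std_gaussian \<equiv> gaussian 0 (mat 1)"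

lemma std_gaussian_eq:
  "std_gaussian = density lborel (\<lambda>y::real^'n. ennreal (exp (- (y \<bullet> y) / 2) / sqrt ((2 * pi) ^ CARD('n))))"
  by (simp add: gaussian_def matrix_inv_eqI[of "mat 1" "mat 1"])

text \<open>
  The density factors into one-dimensional standard normal densities.
\<close>
lemma prob_space_std_gaussian: "prob_space (std_gaussian :: (real^'n) measure)"
proof
  have "exp (- (y \<bullet> y) / 2) / sqrt ((2 * pi) ^ CARD('n)) = (\<Prod>b\<in>Basis. std_normal_density (y \<bullet> b))"
    for y :: "real^'n"
  proof -
    have "- (y \<bullet> y) / 2 = (\<Sum>b\<in>Basis. - (y \<bullet> b)\<^sup>2 / 2)"
      by (subst euclidean_inner) (simp add: power2_eq_square sum_divide_distrib sum_negf)
    then show ?thesis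
      by (simp add: std_normal_density_def prod_dividef exp_sum real_sqrt_power[symmetric])
  qed
  then have "emeasure (std_gaussian :: (real^'n) measure) UNIV
      = (\<integral>\<^sup>+y. (\<Prod>b\<in>Basis. ennreal (std_normal_density (y \<bullet> b))) \<partial>(lborel :: (real^'n) measure))"
    by (simp add: std_gaussian_eq emeasure_density prod_ennreal)
  also have "\<dots> = (\<Prod>b\<in>(Basis :: (real^'n) set). (\<integral>\<^sup>+x. ennreal (std_normal_density x) \<partial>lborel))"
    by (rule nn_integral_lborel_prod) auto
  also have "(\<integral>\<^sup>+x. ennreal (std_normal_density x) \<partial>lborel) = 1"
    by (subst nn_integral_eq_integral) auto
  finally show "emeasure (std_gaussian :: (real^'n) measure) (space std_gaussian) = 1"
    by simp
qed

lemma std_gaussian_AE: "(AE g in lborel. P g) \<Longrightarrow> (AE g in std_gaussian. P g)"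
  unfolding std_gaussian_eq by (subst AE_density) auto

text \<open>
  Substituting \<open>y = \<mu> + A g\<close> turns the quadratic form of \<open>(A A')\<^sup>-\<^sup>1\<close> into \<open>g \<bullet> g\<close>, and the Jacobian
  \<open>\<bar>det A\<bar>\<close> cancels against the square root of \<open>det (A A')\<close> in the normalizing constant.
\<close>
theorem gaussian_eq_distr_std_gaussian:
  fixes A :: "real^'n^'n"
  assumes A: "det A \<noteq> 0"
  shows "gaussian \<mu> (A ** transpose A) = distr std_gaussian borel (\<lambda>g. \<mu> + A *v g)"
proof (rule measure_eqI)
  obtain B where B: "A ** B = mat 1" "B ** A = mat 1"
    using A unfolding invertible_det_nz[symmetric] invertible_def by blast
  have "(A ** transpose A) ** (transpose B ** B) = A ** transpose (B ** A) ** B"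
    by (simp add: matrix_transpose_mul matrix_mul_assoc)
  then have inv: "matrix_inv (A ** transpose A) = transpose B ** B"
    by (intro matrix_inv_eqI) (simp add: B)
  have quad: "(A *v g) \<bullet> ((transpose B ** B) *v (A *v g)) = g \<bullet> g" for g
  proof -
    have "(transpose B ** B) *v (A *v g) = transpose B *v g"
      by (metis B(2) matrix_mul_assoc matrix_mul_rid matrix_vector_mul_assoc)
    then show ?thesis
      by (metis B(2) dot_lmul_matrix inner_commute matrix_vector_mul_assoc matrix_vector_mul_lid transpose_matrix_vector)
  qed
  fix E assume "E \<in> sets (gaussian \<mu> (A ** transpose A))"
  then have [measurable]: "E \<in> sets borel" by simp
  define \<psi> where "\<psi> y = ennreal (exp (- ((y - \<mu>) \<bullet> ((transpose B ** B) *v (y - \<mu>))) / 2)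
      / sqrt ((2 * pi) ^ CARD('n) * (det A * det A)))" for y
  define \<phi> where "\<phi> g = ennreal (exp (- (g \<bullet> g) / 2) / sqrt ((2 * pi) ^ CARD('n)))" for g :: "real^'n"
  have [measurable]: "(\<lambda>y. (transpose B ** B) *v (y - \<mu>)) \<in> borel_measurable borel"
    by (intro borel_measurable_continuous_onI continuous_on_compose2[OF matrix_vector_mult_linear_continuous_on[of UNIV]] continuous_intros) auto
  have [measurable]: "\<psi> \<in> borel_measurable borel" "\<phi> \<in> borel_measurable borel"
    unfolding \<psi>_def \<phi>_def by measurable
  have \<psi>\<phi>: "ennreal \<bar>det A\<bar> * \<psi> (\<mu> + A *v g) = \<phi> g" for g
  proof -
    have "sqrt ((2 * pi) ^ CARD('n) * (det A * det A)) = sqrt ((2 * pi) ^ CARD('n)) * \<bar>det A\<bar>"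
      by (simp only: real_sqrt_mult[of "(2 * pi) ^ CARD('n)"] real_sqrt_abs2)
    then show ?thesis
      using A by (simp add: \<psi>_def \<phi>_def quad ennreal_mult[symmetric])
  qed
  have "emeasure (gaussian \<mu> (A ** transpose A)) E = (\<integral>\<^sup>+y. \<psi> y * indicator E y \<partial>lborel)"
    unfolding gaussian_def inv det_mul det_transpose \<psi>_def[symmetric] by (rule emeasure_density) simp_all
  also have "\<dots> = ennreal \<bar>det A\<bar> * (\<integral>\<^sup>+g. \<psi> (\<mu> + A *v g) * indicator E (\<mu> + A *v g) \<partial>lborel)"
    by (rule nn_integral_lborel_affine[OF A]) simp
  also have "\<dots> = (\<integral>\<^sup>+g. \<phi> g * indicator ((\<lambda>g. \<mu> + A *v g) -` E) g \<partial>lborel)"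
    by (subst nn_integral_cmult[symmetric])
       (simp_all add: mult.assoc[symmetric] \<psi>\<phi> indicator_vimage)
  also have "\<dots> = emeasure std_gaussian ((\<lambda>g. \<mu> + A *v g) -` E)"
    unfolding std_gaussian_eq \<phi>_def[symmetric]
    by (rule emeasure_density[symmetric]) (use measurable_sets[of "\<lambda>g. \<mu> + A *v g" borel borel E] in simp_all)
  also have "\<dots> = emeasure (distr std_gaussian borel (\<lambda>g. \<mu> + A *v g)) E"
    by (simp add: emeasure_distr)
  finally show "emeasure (gaussian \<mu> (A ** transpose A)) E = emeasure (distr std_gaussian borel (\<lambda>g. \<mu> + A *v g)) E" .
qed simp

section \<open>Factorizing convergent sequences of covariance matrices\<close>

lemma symmetric_matrix_inner:
  "symmetric_matrix S \<Longrightarrow> x \<bullet> (S *v y) = y \<bullet> (S *v (x::real^'n))"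
  by (metis dot_lmul_matrix inner_commute symmetric_matrix_def transpose_matrix_vector)

text \<open>
  Gram-Schmidt for the inner product \<open>x \<bullet> S y\<close>, indexed by a finite set of coordinates: a new vector
  is taken Euclidean-orthogonal to all \<open>S v\<^sub>i\<close>, which exists while fewer than \<open>n\<close> vectors are chosen.
\<close>
lemma orthonormal_family_for_pos_def_form:
  fixes S :: "real^'n^'n" and I :: "'n set"
  assumes S: "symmetric_matrix S" "pos_def S"
  shows "\<exists>v. \<forall>i\<in>I. \<forall>j\<in>I. v i \<bullet> (S *v v j) = of_bool (i = j)"
  using finite[of I]
proof (induction I rule: finite_induct)
  case (insert k I)
  then obtain v where v: "\<And>i j. i \<in> I \<Longrightarrow> j \<in> I \<Longrightarrow> v i \<bullet> (S *v v j) = of_bool (i = j)" by blast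
  have "dim ((\<lambda>i. S *v v i) ` I) \<le> card I"
    using insert(1) by (intro order_trans[OF dim_le_card'] card_image_le) auto
  also have "card I < card (insert k I)" using insert by simp
  also have "\<dots> \<le> DIM(real^'n)" by (simp add: card_mono)
  finally obtain x where x: "x \<noteq> 0" "\<And>y. y \<in> span ((\<lambda>i. S *v v i) ` I) \<Longrightarrow> orthogonal x y"
    using orthogonal_to_subspace_exists by blast
  have x0: "x \<bullet> (S *v v i) = 0" if "i \<in> I" for i
    using x(2)[of "S *v v i"] that by (auto intro: span_base simp: orthogonal_def)
  define d where "d = x \<bullet> (S *v x)"
  have d: "d > 0" using S x(1) by (simp add: pos_def_def d_def)
  define w where "w = v(k := (1 / sqrt d) *\<^sub>R x)"
  have "w i \<bullet> (S *v w j) = of_bool (i = j)" if "i \<in> insert k I" "j \<in> insert k I" for i j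
    using that insert(2) d v x0 symmetric_matrix_inner[OF S(1), of "v i" x] 
    by (auto simp: w_def matrix_vector_mult_scaleR d_def[symmetric] real_sqrt_mult[symmetric])
  then show ?case by blast
qed simp

text \<open>
  If the columns of \<open>V\<close> are orthonormal for the form of \<open>S\<close>, then \<open>V' S V = 1\<close>, so \<open>A = (V')\<^sup>-\<^sup>1\<close> is a
  factor.
\<close>
theorem pos_def_factorization:
  fixes S :: "real^'n^'n"
  assumes S: "symmetric_matrix S" "pos_def S"
  obtains A where "A ** transpose A = S" "det A \<noteq> 0"
proof -
  obtain v where v: "\<And>i j::'n. v i \<bullet> (S *v v j) = of_bool (i = j)"
    using orthonormal_family_for_pos_def_form[OF S, of UNIV] by auto
  define V where "V = transpose (\<chi> i. v i)"
  have "(transpose V ** (S ** V)) $ i $ j = v i \<bullet> (S *v v j)" for i j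
    by (simp add: V_def matrix_matrix_mult_def matrix_vector_mult_def inner_vec_def transpose_def)
  then have V: "transpose V ** (S ** V) = mat 1"
    by (simp add: vec_eq_iff v mat_def)
  then have dV: "det V \<noteq> 0"
    by (metis det_I det_mul mult_zero_left mult_zero_right zero_neq_one)
  then obtain U where U: "V ** U = mat 1" "U ** V = mat 1"
    unfolding invertible_det_nz[symmetric] invertible_def by blast
  have "transpose U ** transpose V = mat 1"
    by (metis U(1) matrix_transpose_mul transpose_mat)
  then have "S = transpose U ** (transpose V ** (S ** V)) ** U"
    by (metis U(1) matrix_mul_assoc matrix_mul_lid matrix_mul_rid)
  then have "transpose U ** transpose (transpose U) = S"
    by (simp add: V)
  moreover have "det (transpose U) \<noteq> 0"
    by (metis U(1) det_I det_mul det_transpose mult_zero_right zero_neq_one)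
  ultimately show ?thesis using that by blast
qed

text \<open>
  Modulo the kernel of \<open>A\<close>, which is orthogonal to the range of \<open>A'\<close>, every vector lies in that range.
\<close>
lemma range_matrix_mult_transpose:
  fixes A :: "real^'n^'m"
  shows "range ((*v) (A ** transpose A)) = range ((*v) A)"
proof
  show "range ((*v) (A ** transpose A)) \<subseteq> range ((*v) A)"
    by (auto simp: matrix_vector_mul_assoc[symmetric] simp del: transpose_matrix_vector)
  show "range ((*v) A) \<subseteq> range ((*v) (A ** transpose A))"
  proof (clarify)
    fix x
    let ?R = "range ((*v) (transpose A))"
    have sp: "span ?R = ?R"
      by (intro span_eq_iff[THEN iffD2] linear_subspace_image) auto
    obtain y z where yz: "y \<in> ?R" "\<And>w. w \<in> ?R \<Longrightarrow> orthogonal z w" "x = y + z"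
      using orthogonal_subspace_decomp_exists[of ?R x] unfolding sp by metis
    obtain u where u: "y = transpose A *v u" using yz(1) by blast
    have "(A *v z) \<bullet> (A *v z) = z \<bullet> (transpose A *v (A *v z))"
      by (metis dot_lmul_matrix inner_commute transpose_matrix_vector)
    then have "A *v z = 0"
      using yz(2) by (auto simp: orthogonal_def simp del: transpose_matrix_vector)
    then have "A *v x = (A ** transpose A) *v u"
      by (simp add: yz(3) u matrix_vector_right_distrib matrix_vector_mul_assoc[symmetric] del: transpose_matrix_vector)
    then show "A *v x \<in> range ((*v) (A ** transpose A))" by blast
  qed
qed

lemma span_columns_eq_range:
  fixes A :: "real^'n^'m"
  shows "span (columns A) = range ((*v) A)"
proof
  have "columns A \<subseteq> range ((*v) A)"
    by (auto simp: columns_image_basis)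
  then show "span (columns A) \<subseteq> range ((*v) A)"
    by (intro span_minimal linear_subspace_image) auto
  show "range ((*v) A) \<subseteq> span (columns A)"
    using matrix_vector_mult_in_columnspace by blast
qed

lemma tendsto_matrix_mult_transpose:
  fixes A :: "nat \<Rightarrow> real^'n^'m"
  assumes "A \<longlonglongrightarrow> L"
  shows "(\<lambda>m. A m ** transpose (A m)) \<longlonglongrightarrow> L ** transpose L"
  unfolding matrix_matrix_mult_def transpose_def using assms
  by (intro vec_tendstoI) (auto intro!: tendsto_intros)

lemma tendsto_matrix_vector_mult:
  fixes A :: "nat \<Rightarrow> real^'n^'m"
  assumes "A \<longlonglongrightarrow> L"
  shows "(\<lambda>m. A m *v x) \<longlonglongrightarrow> L *v x"
  unfolding matrix_vector_mult_def using assms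
  by (intro vec_tendstoI) (auto intro!: tendsto_intros)

text \<open>
  The squared length of the \<open>i\<close>-th row of a factor is the \<open>i\<close>-th diagonal entry of the product. So the
  factors of a convergent sequence are bounded, and compactness replaces continuity of the
  factorization, at the price of passing to a subsequence.
\<close>
theorem convergent_factorization:
  fixes S :: "nat \<Rightarrow> real^'n^'n"
  assumes S: "\<And>m. symmetric_matrix (S m)" "\<And>m. pos_def (S m)" and lim: "S \<longlonglongrightarrow> L"
  obtains \<phi> :: "nat \<Rightarrow> nat" and A K where "strict_mono \<phi>" "\<And>m. A m ** transpose (A m) = S (\<phi> m)"
    "\<And>m. det (A m) \<noteq> 0" "A \<longlonglongrightarrow> K" "range ((*v) K) = span (columns L)"
proof -
  have "\<exists>A. \<forall>m. A m ** transpose (A m) = S m \<and> det (A m) \<noteq> 0"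
    using S by (intro choice allI) (metis pos_def_factorization)
  then obtain A where A: "\<And>m. A m ** transpose (A m) = S m" "\<And>m. det (A m) \<noteq> 0" by blast
  obtain c where c: "\<And>m. norm (S m) \<le> c"
    using convergent_imp_bounded[OF lim] by (auto simp: bounded_iff)
  have row: "norm (A m $ i) \<le> sqrt c" for m i
  proof -
    have "(norm (A m $ i))\<^sup>2 = S m $ i $ i"
      by (simp add: A(1)[symmetric] matrix_matrix_mult_def transpose_def power2_norm_eq_inner inner_vec_def)
    also have "\<dots> \<le> c"
      using c[of m] component_le_norm_cart[of "S m $ i" i] Finite_Cartesian_Product.norm_nth_le[of "S m" i] by linarith
    finally show ?thesis by (rule real_le_rsqrt)
  qed
  have "norm (A m) \<le> real CARD('n) * sqrt c" for m
  proof -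
    have "norm (A m) \<le> (\<Sum>i\<in>UNIV. norm (A m $ i))"
      unfolding norm_vec_def[of "A m"] by (rule L2_set_le_sum) simp
    also have "\<dots> \<le> real CARD('n) * sqrt c"
      by (rule sum_bounded_above) (rule row)
    finally show ?thesis .
  qed
  then have "bounded (range A)" by (auto simp: bounded_iff)
  then obtain K \<phi> where \<phi>: "strict_mono (\<phi> :: nat \<Rightarrow> nat)" "(A \<circ> \<phi>) \<longlonglongrightarrow> K"
    using bounded_imp_convergent_subsequence by blast
  have "(\<lambda>m. (A \<circ> \<phi>) m ** transpose ((A \<circ> \<phi>) m)) \<longlonglongrightarrow> K ** transpose K"
    using tendsto_matrix_mult_transpose[OF \<phi>(2)] .
  moreover have "(\<lambda>m. (A \<circ> \<phi>) m ** transpose ((A \<circ> \<phi>) m)) \<longlonglongrightarrow> L"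
    using LIMSEQ_subseq_LIMSEQ[OF lim \<phi>(1)] by (simp add: A o_def)
  ultimately have "K ** transpose K = L" by (rule LIMSEQ_unique)
  then have "range ((*v) K) = span (columns L)"
    by (metis range_matrix_mult_transpose span_columns_eq_range)
  then show ?thesis
    using that[of \<phi> "A \<circ> \<phi>" K] \<phi> A by auto
qed

section \<open>Null sets for Lebesgue measure on a subspace\<close>

lemma PiM_lborel_translate:
  fixes d :: "'b \<Rightarrow> real"
  assumes "finite B"
  shows "distr (PiM B (\<lambda>_. lborel)) (PiM B (\<lambda>_. lborel)) (\<lambda>c. \<lambda>b\<in>B. d b + c b) = PiM B (\<lambda>_. lborel)"
proof -
  interpret product_sigma_finite "\<lambda>_::'b. lborel :: real measure" ..
  show ?thesis
  proof (rule PiM_eqI[OF assms])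
    fix E :: "'b \<Rightarrow> real set" assume "\<And>b. b \<in> B \<Longrightarrow> E b \<in> sets lborel"
    then have E: "b \<in> B \<Longrightarrow> E b \<in> sets borel" for b by simp
    have pre: "(\<lambda>c. \<lambda>b\<in>B. d b + c b) -` Pi\<^sub>E B E \<inter> space (PiM B (\<lambda>_. lborel)) = Pi\<^sub>E B (\<lambda>b. (+) (d b) -` E b)"
      by (auto simp: space_PiM PiE_iff)
    have V: "(+) (d b) -` E b \<in> sets borel" if "b \<in> B" for b
      using measurable_sets[of "(+) (d b)" borel borel "E b"] E[OF that] by simp
    have "emeasure lborel ((+) (d b) -` E b) = emeasure lborel (E b)" if "b \<in> B" for b
      by (subst (2) lborel_distr_plus[of "d b", symmetric]) (use E[OF that] in \<open>simp add: emeasure_distr\<close>)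
    then show "emeasure (distr (PiM B (\<lambda>_. lborel)) (PiM B (\<lambda>_. lborel)) (\<lambda>c. \<lambda>b\<in>B. d b + c b)) (Pi\<^sub>E B E)
        = (\<Prod>b\<in>B. emeasure lborel (E b))"
      using E V assms
      by (subst emeasure_distr)
         (auto simp: pre intro!: sets_PiM_I_finite emeasure_PiM[THEN trans] prod.cong)
  qed simp
qed

lemma AE_PiM_lborel_translate:
  fixes d :: "'b \<Rightarrow> real"
  assumes "finite B" "AE c in PiM B (\<lambda>_. lborel). P c"
  shows "AE c in PiM B (\<lambda>_. lborel). P (\<lambda>b\<in>B. d b + c b)"
proof -
  have "AE c in distr (PiM B (\<lambda>_. lborel)) (PiM B (\<lambda>_. lborel)) (\<lambda>c. \<lambda>b\<in>B. d b + c b). P c"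
    unfolding PiM_lborel_translate[OF assms(1)] by (rule assms(2))
  then show ?thesis
    by (rule AE_distrD[rotated]) measurable
qed

text \<open>
  Let \<open>w\<^sub>c\<close> be a preimage under \<open>L\<close> of the point of the range with coordinates \<open>c\<close>. For fixed \<open>g\<close>, the
  point \<open>L (w\<^sub>c + g)\<close> is a translate of the point with coordinates \<open>c\<close>, so it avoids a null set \<open>E\<close> for
  almost every \<open>c\<close>. By Fubini some \<open>c\<close> works for almost every \<open>g\<close>, and translating by \<open>- w\<^sub>c\<close> removes
  it.
\<close>
lemma AE_lebesgue_on_subspace_pullback:
  fixes L :: "'b::euclidean_space \<Rightarrow> 'a::euclidean_space"
  assumes L: "linear L" and ae: "AE z in lebesgue_on_subspace (range L). P z"
  shows "AE g in lborel. P (L g)"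
proof -
  define B where "B = (SOME B. is_onb (range L) B)"
  have "is_onb (range L) B"
    unfolding B_def by (rule someI_ex, rule is_onb_exists, rule linear_subspace_image[OF L]) simp
  then have B: "pairwise orthogonal B" "\<And>b. b \<in> B \<Longrightarrow> norm b = 1" "span B = range L"
    by (auto simp: is_onb_def)
  have "0 \<notin> B" using B(2) by force
  then have fin: "finite B"
    using B(1) by (intro independent_imp_finite pairwise_orthogonal_independent)
  let ?M = "PiM B (\<lambda>_. lborel :: real measure)"
  let ?s = "\<lambda>c::'a \<Rightarrow> real. \<Sum>b\<in>B. c b *\<^sub>R b"
  interpret product_sigma_finite "\<lambda>_::'a. lborel :: real measure" ..
  interpret M: finite_product_sigma_finite "\<lambda>_::'a. lborel :: real measure" B by standard (rule fin)
  interpret LM: pair_sigma_finite "lborel :: 'b measure" ?M ..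
  have [measurable]: "?s \<in> borel_measurable ?M" by measurable
  have [measurable]: "L \<in> borel_measurable borel"
    by (rule linear_borel_measurable[OF L])
  obtain E where E: "E \<in> null_sets (distr ?M borel ?s)" "{z. \<not> P z} \<subseteq> E"
    using ae unfolding lebesgue_on_subspace_def B_def[symmetric] Let_def eventually_ae_filter by auto
  then have [measurable]: "E \<in> sets borel" by auto
  have aeE: "AE c in ?M. ?s c \<notin> E"
    using AE_distrD[OF _ AE_not_in[OF E(1)]] by simp
  obtain a where a: "\<And>b. b \<in> B \<Longrightarrow> L (a b) = b"
  proof -
    have "\<forall>b\<in>B. \<exists>g. L g = b" using B(3) span_base[of _ B] by (metis image_iff)
    then show thesis using that by metis
  qed
  define w where "w c = (\<Sum>b\<in>B. c b *\<^sub>R a b)" for c :: "'a \<Rightarrow> real"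
  have [measurable]: "w \<in> borel_measurable ?M" unfolding w_def by measurable
  have Lw: "L (w c) = ?s c" for c
    unfolding w_def using L a by (simp add: linear_sum linear_scale)
  have fiber: "AE c in ?M. L (w c + g) \<notin> E" for g
  proof -
    have "L g \<in> span B" using B(3) by blast
    then obtain d where d: "L g = ?s d"
      unfolding span_finite[OF fin] by blast
    have "L (w c + g) = ?s (\<lambda>b\<in>B. d b + c b)" for c
    proof -
      have "L (w c + g) = ?s c + ?s d"
        using L by (simp only: linear_add Lw d)
      also have "\<dots> = (\<Sum>b\<in>B. (d b + c b) *\<^sub>R b)"
        by (simp add: sum.distrib scaleR_left_distrib)
      finally show ?thesis by simp
    qed
    then show ?thesis
      using AE_PiM_lborel_translate[OF fin aeE, of d] by simp
  qed
  have "AE g in lborel. AE c in ?M. L (w c + g) \<notin> E"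
    by (simp add: fiber)
  then have comm: "AE c in ?M. AE g in lborel. L (w c + g) \<notin> E"
    by (subst (asm) LM.AE_commute) measurable
  have "emeasure ?M (space ?M) \<noteq> 0"
    using fin by (simp add: space_PiM emeasure_PiM)
  then have nontrivial: "\<not> (AE c in ?M. False)"
    by (auto simp: AE_iff_measurable[OF _ refl])
  obtain c where c: "AE g in lborel. L (w c + g) \<notin> E"
    using eventually_mono[OF comm, of "\<lambda>_. False"] nontrivial by blast
  have "AE g in distr lborel borel ((+) (- w c)). L (w c + g) \<notin> E"
    unfolding lborel_distr_plus by (rule c)
  then have "AE g in lborel. L g \<notin> E"
    by (subst (asm) AE_distr_iff) auto
  then show ?thesis
    by eventually_elim (use E(2) in auto)
qed

section \<open>Concentration of Gaussian measures\<close>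

lemma covariance_modelD:
  assumes "covariance_model CC" "S \<in> CC"
  shows "symmetric_matrix S" "pos_def S"
  using assms unfolding covariance_model_def by blast+

lemma (in prob_space) prob_eventually_tendsto_1:
  assumes meas: "\<And>m. {x\<in>space M. Q m x} \<in> sets M"
    and ae: "AE x in M. eventually (\<lambda>m::nat. Q m x) sequentially"
  shows "(\<lambda>m. prob {x\<in>space M. Q m x}) \<longlonglongrightarrow> 1"
proof -
  let ?E = "\<lambda>m. {x\<in>space M. Q m x}"
  have "(\<lambda>m. \<integral>x. indicator (?E m) x \<partial>M) \<longlonglongrightarrow> (\<integral>x. (1::real) \<partial>M)"
  proof (rule integral_dominated_convergence[where w="\<lambda>_. 1"])
    show "AE x in M. (\<lambda>m. indicator (?E m) x) \<longlonglongrightarrow> (1::real)"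
      using ae AE_space
    proof eventually_elim
      case (elim x)
      then have "eventually (\<lambda>m. indicator (?E m) x = (1::real)) sequentially"
        by (auto elim: eventually_mono)
      then show ?case by (rule tendsto_eventually)
    qed
    show "indicator (?E m) \<in> borel_measurable M" for m using meas by simp
  qed (auto split: split_indicator)
  then show ?thesis
    using meas by (simp add: prob_space)
qed

lemma prob_space_gaussian:
  assumes "symmetric_matrix \<Phi>" "pos_def \<Phi>"
  shows "prob_space (gaussian \<mu> \<Phi>)"
proof -
  obtain A where A: "A ** transpose A = \<Phi>" "det A \<noteq> 0" using pos_def_factorization[OF assms] .
  interpret prob_space std_gaussian by (rule prob_space_std_gaussian)
  have "prob_space (distr std_gaussian borel (\<lambda>g. \<mu> + A *v g))"
    by (rule prob_space_distr) measurable
  then show ?thesis using gaussian_eq_distr_std_gaussian[OF A(2)] A(1) by simp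
qed

lemma gaussian_null_sets:
  assumes "E \<in> null_sets lborel"
  shows "E \<in> null_sets (gaussian \<mu> \<Phi>)"
proof -
  have "(\<lambda>y. matrix_inv \<Phi> *v (y - \<mu>)) \<in> borel_measurable borel"
    by (intro borel_measurable_continuous_onI continuous_on_compose2[OF matrix_vector_mult_linear_continuous_on[of UNIV]] continuous_intros) auto
  then show ?thesis
    unfolding gaussian_def using assms AE_not_in[OF assms]
    by (subst null_sets_density_iff) auto
qed

text \<open>
  Realized on one probability space, the Gaussian vectors \<open>x\<^sub>m + A\<^sub>m g\<close> converge to \<open>K g\<close>, which almost
  surely lies in the interior of \<open>V\<close>; so almost surely they eventually lie in \<open>V\<close> themselves.
\<close>
theorem gaussian_concentration:
  fixes V Z :: "(real^'n) set"
  assumes CC: "covariance_model CC" and Z: "concentration_space CC Z"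
    and V: "V \<in> sets borel" and int: "AE z in lebesgue_on_subspace Z. z \<in> interior V"
    and x: "x \<longlonglongrightarrow> 0"
  obtains S where "\<And>m::nat. S m \<in> CC" "(\<lambda>m. measure (gaussian (x m) (S m)) V) \<longlonglongrightarrow> 1"
proof -
  obtain S L where S: "\<And>m::nat. S m \<in> CC" "S \<longlonglongrightarrow> L" "span (columns L) = Z"
    using Z unfolding concentration_space_def by blast
  note spd = covariance_modelD[OF CC S(1)]
  obtain \<phi> :: "nat \<Rightarrow> nat" and A K where A: "\<And>m. A m ** transpose (A m) = S (\<phi> m)"
      "\<And>m. det (A m) \<noteq> 0" "A \<longlonglongrightarrow> K" "range ((*v) K) = Z"
    using convergent_factorization[of S L] spd S(2,3) by metis
  interpret std: prob_space "std_gaussian :: (real^'n) measure" by (rule prob_space_std_gaussian)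
  have "AE g in lborel. K *v g \<in> interior V"
    using int A(4) by (intro AE_lebesgue_on_subspace_pullback) auto
  then have "AE g in std_gaussian. K *v g \<in> interior V"
    by (rule std_gaussian_AE)
  then have ae: "AE g in std_gaussian. eventually (\<lambda>m. x m + A m *v g \<in> V) sequentially"
  proof eventually_elim
    case (elim g)
    have "(\<lambda>m. x m + A m *v g) \<longlonglongrightarrow> 0 + K *v g"
      by (intro tendsto_add x tendsto_matrix_vector_mult A(3))
    then have "eventually (\<lambda>m. x m + A m *v g \<in> interior V) sequentially"
      using elim by (intro topological_tendstoD[where l="K *v g"]) auto
    then show ?case
      by eventually_elim (use interior_subset in blast)
  qed
  have pre: "{g. x m + A m *v g \<in> V} \<in> sets borel" for m
    using V by measurable
  have "measure (gaussian (x m) (S (\<phi> m))) V = std.prob {g. x m + A m *v g \<in> V}" for m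
    unfolding A(1)[symmetric] gaussian_eq_distr_std_gaussian[OF A(2)]
    using V by (simp add: measure_distr vimage_def)
  moreover have "(\<lambda>m. std.prob {g. x m + A m *v g \<in> V}) \<longlonglongrightarrow> 1"
    using std.prob_eventually_tendsto_1[of "\<lambda>m g. x m + A m *v g \<in> V"] pre ae by simp
  ultimately show ?thesis
    using that[of "S \<circ> \<phi>"] S(1) by simp
qed

lemma measure_gaussian_affine:
  fixes \<mu> \<nu> :: "real^'n"
  assumes \<Phi>: "symmetric_matrix \<Phi>" "pos_def \<Phi>" and "c \<noteq> 0" and W: "W \<in> sets borel" "W' \<in> sets borel"
    and eq: "\<And>y. \<nu> + c *\<^sub>R y \<in> W \<longleftrightarrow> y \<in> W'"
  shows "measure (gaussian (\<nu> + c *\<^sub>R \<mu>) (c\<^sup>2 *\<^sub>R \<Phi>)) W = measure (gaussian \<mu> \<Phi>) W'"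
proof -
  obtain A where A: "A ** transpose A = \<Phi>" "det A \<noteq> 0" using pos_def_factorization[OF \<Phi>] .
  have cA: "(c *\<^sub>R A) ** transpose (c *\<^sub>R A) = c\<^sup>2 *\<^sub>R \<Phi>"
    by (simp add: A(1)[symmetric] transpose_scalar matrix_scalar_ac power2_eq_square scalar_matrix_assoc[symmetric])
  have "det (c *\<^sub>R A) \<noteq> 0"
    using A(2) \<open>c \<noteq> 0\<close> scalar_invertible[of c A] by (simp add: invertible_det_nz)
  note g1 = gaussian_eq_distr_std_gaussian[OF this, of "\<nu> + c *\<^sub>R \<mu>", unfolded cA]
    and g2 = gaussian_eq_distr_std_gaussian[OF A(2), of \<mu>, unfolded A(1)]
  have "(\<lambda>g. \<nu> + c *\<^sub>R \<mu> + (c *\<^sub>R A) *v g) -` W = (\<lambda>g. \<mu> + A *v g) -` W'"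
    using eq[of "\<mu> + A *v g" for g] by (auto simp: scaleR_matrix_vector_assoc[symmetric] algebra_simps)
  then show ?thesis
    unfolding g1 g2 using W by (simp add: measure_distr)
qed

section \<open>Continuity of matrix expressions and quadratic forms of inverses\<close>

lemma continuous_on_det:
  fixes f :: "'a::topological_space \<Rightarrow> real^'n^'n"
  assumes "continuous_on S f"
  shows "continuous_on S (\<lambda>x. det (f x))"
  unfolding det_def using assms by (intro continuous_intros)

lemma continuous_on_matrix_vector_mult:
  fixes f :: "'a::topological_space \<Rightarrow> real^'n^'m"
  assumes "continuous_on S f" "continuous_on S v"
  shows "continuous_on S (\<lambda>x. f x *v v x)"
  unfolding matrix_vector_mult_def using assms by (intro continuous_intros)

lemma matrix_inv_vector_eq:
  fixes M :: "real^'n^'n"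
  assumes "det M \<noteq> 0"
  shows "M *v (matrix_inv M *v v) = v"
  using matrix_inv_right[OF assms] by (simp add: matrix_vector_mul_assoc)

text \<open>
  Cramer's rule writes the components as quotients of determinants, which are polynomials.
\<close>
lemma continuous_on_matrix_inv_vector_mult:
  fixes f :: "'a::topological_space \<Rightarrow> real^'n^'n"
  assumes "continuous_on S f" "continuous_on S v" and nz: "\<And>x. x \<in> S \<Longrightarrow> det (f x) \<noteq> 0"
  shows "continuous_on S (\<lambda>x. matrix_inv (f x) *v v x)"
proof -
  have eq: "matrix_inv (f x) *v v x = (\<chi> k. det (\<chi> i j. if j = k then v x $ i else f x $ i $ j) / det (f x))"
    if "x \<in> S" for x
    using cramer[OF nz[OF that], of "matrix_inv (f x) *v v x" "v x"] matrix_inv_vector_eq[OF nz[OF that]] by simp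
  have ent: "continuous_on S (\<lambda>x. if j = k then v x $ i else f x $ i $ j)" for i j k
    using assms(1,2) by (cases "j = k") (auto intro!: continuous_intros)
  have "continuous_on S (\<lambda>x. (\<chi> k. det (\<chi> i j. if j = k then v x $ i else f x $ i $ j) / det (f x)))"
    using assms by (intro continuous_on_vec_lambda continuous_on_divide continuous_on_det ent) auto
  then show ?thesis
    by (rule continuous_on_eq) (simp add: eq)
qed

lemma matrix_inv_scaleR:
  fixes M :: "real^'n^'n"
  assumes "det M \<noteq> 0" "c \<noteq> 0"
  shows "matrix_inv (c *\<^sub>R M) = (1 / c) *\<^sub>R matrix_inv M"
  using assms by (intro matrix_inv_eqI) (simp add: matrix_inv_right matrix_scalar_ac scalar_matrix_assoc[symmetric])

text \<open>
  A form of the Cauchy-Schwarz inequality \<open>(v \<bullet> v)\<^sup>2 \<le> (v \<bullet> M v) (v \<bullet> M\<^sup>-\<^sup>1 v)\<close> for the form of \<open>M\<close>: it makes the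
  test statistic large where the covariance estimator is small.
\<close>
lemma nonneg_def_inverse_form_ge:
  fixes M :: "real^'q^'q"
  assumes sym: "symmetric_matrix M" and nn: "nonneg_def M" and inv: "det M \<noteq> 0" and C: "0 < C"
    and small: "C * (v \<bullet> (M *v v)) < (v \<bullet> v)\<^sup>2"
  shows "v \<bullet> (matrix_inv M *v v) \<ge> C"
proof (rule ccontr)
  define w where "w = matrix_inv M *v v"
  have Mw: "M *v w = v" unfolding w_def by (rule matrix_inv_vector_eq[OF inv])
  assume "\<not> v \<bullet> (matrix_inv M *v v) \<ge> C"
  then have lt: "v \<bullet> w < C" by (simp add: w_def)
  \<comment> \<open>The value of \<open>t\<close> minimizing the upper bound \<open>v \<bullet> M v - 2 t (v \<bullet> v) + t\<^sup>2 C\<close> for the form of \<open>M\<close> at \<open>v - t w\<close>.\<close>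
  define t where "t = (v \<bullet> v) / C"
  have "w \<bullet> (M *v v) = v \<bullet> v"
    by (metis Mw dot_lmul_matrix sym symmetric_matrix_def transpose_matrix_vector)
  then have "(v - t *\<^sub>R w) \<bullet> (M *v (v - t *\<^sub>R w)) = v \<bullet> (M *v v) - 2 * t * (v \<bullet> v) + t\<^sup>2 * (v \<bullet> w)"
    by (simp add: matrix_vector_mult_diff_distrib matrix_vector_mult_scaleR Mw inner_diff_left
        inner_diff_right power2_eq_square inner_commute algebra_simps)
  then have "0 \<le> v \<bullet> (M *v v) - 2 * t * (v \<bullet> v) + t\<^sup>2 * (v \<bullet> w)"
    using nn unfolding nonneg_def_def by metis
  also have "\<dots> \<le> v \<bullet> (M *v v) - 2 * t * (v \<bullet> v) + t\<^sup>2 * C"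
    using lt by (simp add: mult_left_mono)
  also have "\<dots> = v \<bullet> (M *v v) - (v \<bullet> v)\<^sup>2 / C"
    using C by (simp add: t_def power2_eq_square)
  finally show False
    using small C by (simp add: field_simps)
qed

section \<open>Equivariant test statistics\<close>

locale equivariant_test =
  fixes X :: "real^'k^'n" and b :: "real^'n \<Rightarrow> real^'k" and \<Omega> :: "real^'n \<Rightarrow> real^'q^'q"
    and N :: "(real^'n) set" and R :: "real^'k^'q"
  assumes pair: "regular_equivariant_pair X b \<Omega> N"
begin

lemma closed_N: "closed N" and null_N: "N \<in> null_sets lborel"
  and continuous_b: "continuous_on (- N) b" and continuous_\<Omega>: "continuous_on (- N) \<Omega>"
  and symmetric_\<Omega>: "y \<notin> N \<Longrightarrow> symmetric_matrix (\<Omega> y)"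
  and N_affine: "y \<notin> N \<Longrightarrow> \<alpha> \<noteq> 0 \<Longrightarrow> \<alpha> *\<^sub>R y + X *v \<gamma> \<notin> N"
  and b_affine: "y \<notin> N \<Longrightarrow> \<alpha> \<noteq> 0 \<Longrightarrow> b (\<alpha> *\<^sub>R y + X *v \<gamma>) = \<alpha> *\<^sub>R b y + \<gamma>"
  and \<Omega>_affine: "y \<notin> N \<Longrightarrow> \<alpha> \<noteq> 0 \<Longrightarrow> \<Omega> (\<alpha> *\<^sub>R y + X *v \<gamma>) = \<alpha>\<^sup>2 *\<^sub>R \<Omega> y"
  and AE_\<Omega>: "AE y in lborel. y \<notin> N \<longrightarrow> invertible (\<Omega> y)"
  using pair unfolding regular_equivariant_pair_def by blast+

abbreviation "Ns \<equiv> N_star \<Omega> N"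
abbreviation "T r \<equiv> test_stat R r b \<Omega> N"
abbreviation "W r C \<equiv> rejection_region R r b \<Omega> N C"

lemma not_in_N_star: "y \<notin> Ns \<longleftrightarrow> y \<notin> N \<and> det (\<Omega> y) \<noteq> 0"
  by (auto simp: N_star_def)

lemma det_scaleR_nz: "c \<noteq> 0 \<Longrightarrow> det (M :: real^'q^'q) \<noteq> 0 \<Longrightarrow> det (c *\<^sub>R M) \<noteq> 0"
  using scalar_invertible[of c M] by (simp add: invertible_det_nz)

lemma N_star_affine_imp: "y \<notin> Ns \<Longrightarrow> \<alpha> \<noteq> 0 \<Longrightarrow> X *v \<gamma> + \<alpha> *\<^sub>R y \<notin> Ns"
  using N_affine[of y \<alpha> \<gamma>] \<Omega>_affine[of y \<alpha> \<gamma>] det_scaleR_nz[of "\<alpha>\<^sup>2" "\<Omega> y"]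
  by (simp add: not_in_N_star add.commute)

lemma N_star_affine:
  assumes "\<alpha> \<noteq> 0" shows "X *v \<gamma> + \<alpha> *\<^sub>R y \<in> Ns \<longleftrightarrow> y \<in> Ns"
proof -
  have "X *v ((- 1 / \<alpha>) *\<^sub>R \<gamma>) + (1 / \<alpha>) *\<^sub>R (X *v \<gamma> + \<alpha> *\<^sub>R y) = y"
    by (subst matrix_vector_mult_scaleR) (use assms in \<open>simp add: scaleR_right_distrib\<close>)
  then show ?thesis
    using N_star_affine_imp[of y \<alpha> \<gamma>] N_star_affine_imp[of "X *v \<gamma> + \<alpha> *\<^sub>R y" "1 / \<alpha>" "(- 1 / \<alpha>) *\<^sub>R \<gamma>"] assms
    by fastforce
qed

text \<open>
  The factor \<open>\<alpha>\<close> enters the numerator squared and cancels against \<open>\<alpha>\<^sup>2\<close> from the covariance estimator;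
  the shift by \<open>X \<beta>\<close> is absorbed by \<open>R \<beta> = r\<close>. On the exceptional set both sides are \<open>0\<close> by convention.
\<close>
lemma test_stat_affine:
  assumes "\<alpha> \<noteq> 0" "R *v \<beta> = r"
  shows "T r (X *v \<beta> + \<alpha> *\<^sub>R y) = T 0 y"
proof (cases "y \<in> Ns")
  case True
  then show ?thesis using N_star_affine[OF assms(1), of \<beta> y] by (simp add: test_stat_def)
next
  case False
  then have y: "y \<notin> N" "det (\<Omega> y) \<noteq> 0" by (simp_all add: not_in_N_star)
  have "R *v b (X *v \<beta> + \<alpha> *\<^sub>R y) - r = \<alpha> *\<^sub>R (R *v b y)"
    using b_affine[OF y(1) assms(1), of \<beta>] assms(2)
    by (simp add: add.commute matrix_vector_right_distrib matrix_vector_mult_scaleR)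
  moreover have "matrix_inv (\<Omega> (X *v \<beta> + \<alpha> *\<^sub>R y)) = (1 / \<alpha>\<^sup>2) *\<^sub>R matrix_inv (\<Omega> y)"
    using \<Omega>_affine[OF y(1) assms(1), of \<beta>] matrix_inv_scaleR[OF y(2), of "\<alpha>\<^sup>2"] assms(1)
    by (simp add: add.commute)
  ultimately show ?thesis
    using False assms(1) N_star_affine[OF assms(1), of \<beta> y]
    by (simp add: test_stat_def matrix_vector_mult_scaleR scaleR_matrix_vector_assoc[symmetric] power2_eq_square)
qed

lemma rejection_region_affine:
  assumes "\<alpha> \<noteq> 0" "R *v \<beta> = r"
  shows "X *v \<beta> + \<alpha> *\<^sub>R y \<in> W r C \<longleftrightarrow> y \<in> W 0 C"
  by (simp add: rejection_region_def test_stat_affine[OF assms])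

lemma open_compl_N_star: "open (- Ns)"
proof -
  have "- Ns = - N \<inter> (\<lambda>y. det (\<Omega> y)) -` (- {0})"
    by (auto simp: N_star_def)
  moreover have "open (- N \<inter> (\<lambda>y. det (\<Omega> y)) -` (- {0}))"
    using closed_N continuous_on_det[OF continuous_\<Omega>] by (intro continuous_open_preimage) auto
  ultimately show ?thesis by simp
qed

lemma continuous_test_stat: "continuous_on (- Ns) (T r)"
proof -
  have sub: "- Ns \<subseteq> - N" by (auto simp: N_star_def)
  have v: "continuous_on (- Ns) (\<lambda>y. R *v b y - r)"
    using continuous_on_subset[OF continuous_b sub]
    by (intro continuous_intros continuous_on_matrix_vector_mult)
  have "continuous_on (- Ns) (\<lambda>y. (R *v b y - r) \<bullet> (matrix_inv (\<Omega> y) *v (R *v b y - r)))"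
    using continuous_on_subset[OF continuous_\<Omega> sub] v
    by (intro continuous_on_inner continuous_on_matrix_inv_vector_mult) (auto simp: N_star_def)
  then show ?thesis
    by (rule continuous_on_eq) (auto simp: test_stat_def)
qed

lemma open_test_stat_preimage: "open U \<Longrightarrow> open (- Ns \<inter> T r -` U)"
  by (rule continuous_open_preimage[OF continuous_test_stat open_compl_N_star])

text \<open>
  Since \<open>C\<close> is positive, the convention that the statistic vanishes on \<open>N\<^sup>*\<close> keeps \<open>N\<^sup>*\<close> out of the region.
\<close>
lemma rejection_region_eq: "0 < C \<Longrightarrow> W r C = - Ns - (- Ns \<inter> T r -` {..<C})"
  by (auto simp: rejection_region_def test_stat_def)

lemma sets_rejection_region: "0 < C \<Longrightarrow> W r C \<in> sets borel"
  by (simp only: rejection_region_eq)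
     (intro sets.Diff borel_open open_compl_N_star open_test_stat_preimage open_lessThan)

lemma N_star_null: "Ns \<in> null_sets lborel"
proof -
  have "Ns \<in> sets borel"
    using borel_open[OF open_compl_N_star] by (metis borel_comp double_compl)
  moreover have "AE y in lborel. y \<notin> Ns"
    using AE_not_in[OF null_N] AE_\<Omega>
    by eventually_elim (auto simp: not_in_N_star invertible_det_nz)
  ultimately show ?thesis by (simp add: AE_iff_null_sets)
qed

lemma interior_rejection_region:
  assumes "z \<notin> Ns" "T 0 z > C"
  shows "z \<in> interior (W 0 C)"
  by (rule interiorI[OF open_test_stat_preimage[of "{C<..}" 0]])
     (use assms in \<open>auto simp: rejection_region_def\<close>)

lemma interior_acceptance_region:
  assumes "z \<notin> Ns" "T 0 z < C"
  shows "z \<in> interior (- W 0 C)"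
  by (rule interiorI[OF open_test_stat_preimage[of "{..<C}" 0]])
     (use assms in \<open>auto simp: rejection_region_def\<close>)

text \<open>
  Near \<open>z\<close> the form of the covariance estimator at \<open>R b\<close> is small compared with \<open>(R b \<bullet> R b)\<^sup>2\<close>. Off
  \<open>N\<^sup>*\<close> this forces the statistic above \<open>C\<close>; points of \<open>N\<^sup>*\<close>, where the statistic is set to \<open>0\<close>, may
  accumulate at \<open>z\<close> and have to be added to the region.
\<close>
lemma interior_rejection_region_degenerate:
  assumes C: "0 < C" and nn: "\<And>y. y \<notin> N \<Longrightarrow> nonneg_def (\<Omega> y)"
    and z: "z \<notin> N" "\<Omega> z = 0" "R *v b z \<noteq> 0"
  shows "z \<in> interior (W 0 C \<union> Ns)"
proof -
  let ?v = "\<lambda>y. R *v b y"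
  let ?f = "\<lambda>y. (?v y \<bullet> ?v y)\<^sup>2 - C * (?v y \<bullet> (\<Omega> y *v ?v y))"
  have v: "continuous_on (- N) ?v"
    by (intro continuous_on_matrix_vector_mult continuous_b continuous_intros)
  have "continuous_on (- N) ?f"
    by (intro continuous_intros v continuous_on_matrix_vector_mult continuous_\<Omega>)
  then have op: "open (- N \<inter> ?f -` {0<..})"
    using closed_N by (intro continuous_open_preimage) auto
  show ?thesis
  proof (rule interiorI[OF op])
    show "z \<in> - N \<inter> ?f -` {0<..}" using z by simp
    show "- N \<inter> ?f -` {0<..} \<subseteq> W 0 C \<union> Ns"
    proof
      fix y assume y: "y \<in> - N \<inter> ?f -` {0<..}"
      show "y \<in> W 0 C \<union> Ns"
      proof (cases "y \<in> Ns")
        case False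
        then have "?v y \<bullet> (matrix_inv (\<Omega> y) *v ?v y) \<ge> C"
          using y nn symmetric_\<Omega> C by (intro nonneg_def_inverse_form_ge) (auto simp: not_in_N_star)
        then show ?thesis using False by (simp add: rejection_region_def test_stat_def)
      qed simp
    qed
  qed
qed

end

section \<open>Size and power\<close>

lemma cSUP_eq_of_tendsto:
  fixes f :: "'i \<Rightarrow> real"
  assumes "\<And>i. i \<in> I \<Longrightarrow> f i \<le> c" and "\<And>m::nat. k m \<in> I" and "a \<longlonglongrightarrow> c" and "\<And>m. a m \<le> f (k m)"
  shows "(SUP i\<in>I. f i) = c"
proof (rule antisym)
  show "(SUP i\<in>I. f i) \<le> c"
    using assms(1,2) by (intro cSUP_least) blast+
  have "bdd_above (f ` I)" using assms(1) by (intro bdd_aboveI2[where M=c])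
  then have "a m \<le> (SUP i\<in>I. f i)" for m
    using assms(4)[of m] cSUP_upper[OF assms(2)[of m], of f] by linarith
  then show "c \<le> (SUP i\<in>I. f i)"
    using assms(3) by (intro LIMSEQ_le_const2) auto
qed

lemma cINF_eq_of_tendsto:
  fixes f :: "'i \<Rightarrow> real"
  assumes "\<And>i. i \<in> I \<Longrightarrow> c \<le> f i" and "\<And>m::nat. k m \<in> I" and "a \<longlonglongrightarrow> c" and "\<And>m. f (k m) \<le> a m"
  shows "(INF i\<in>I. f i) = c"
proof (rule antisym)
  show "c \<le> (INF i\<in>I. f i)"
    using assms(1,2) by (intro cINF_greatest) blast+
  have "bdd_below (f ` I)" using assms(1) by (intro bdd_belowI2[where m=c])
  then have "(INF i\<in>I. f i) \<le> a m" for m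
    using assms(4)[of m] cINF_lower[OF _ assms(2)[of m], of f] by linarith
  then show "(INF i\<in>I. f i) \<le> c"
    using assms(3) by (intro LIMSEQ_le_const) auto
qed

lemma pos_def_scaleR:
  assumes "0 < s" "symmetric_matrix S" "pos_def S"
  shows "symmetric_matrix (s *\<^sub>R S)" "pos_def (s *\<^sub>R S)"
  using assms by (auto simp: symmetric_matrix_def pos_def_def transpose_scalar scaleR_matrix_vector_assoc[symmetric])

lemma null_space_nonempty:
  fixes X :: "real^'k^'n" and R :: "real^'k^'q"
  assumes "rank R = CARD('q)"
  shows "null_space X R r \<noteq> {}"
proof -
  have "surj ((*v) R)" using assms full_rank_surjective by blast
  then obtain \<beta> where "R *v \<beta> = r" by (metis surjD)
  then show ?thesis by (auto simp: null_space_def)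
qed

lemma alt_space_eq:
  fixes X :: "real^'k^'n" and R :: "real^'k^'q"
  assumes "rank X = CARD('k)"
  shows "alt_space X R r = {X *v \<beta> | \<beta>. R *v \<beta> \<noteq> r}"
proof -
  have inj: "inj ((*v) X)" using assms full_rank_injective by blast
  show ?thesis
    unfolding alt_space_def null_space_def regr_space_def span_columns_eq_range
    using inj by (auto dest: injD)
qed

text \<open>
  The reduction that makes the mean under the null hypothesis and the scale \<open>s\<close> disappear. Only the
  deviation \<open>\<delta>\<close> from the null hypothesis, measured in units of \<open>\<surd>s\<close>, remains.
\<close>
lemma (in equivariant_test) measure_rejection_region:
  assumes S: "symmetric_matrix S" "pos_def S" and s: "0 < s" and C: "0 < C" and \<beta>: "R *v \<beta> = r"
  shows "measure (gaussian (X *v (\<beta> + \<delta>)) (s *\<^sub>R S)) (W r C) = measure (gaussian (X *v ((1 / sqrt s) *\<^sub>R \<delta>)) S) (W 0 C)"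
proof -
  have eq: "X *v (\<beta> + \<delta>) = X *v \<beta> + sqrt s *\<^sub>R (X *v ((1 / sqrt s) *\<^sub>R \<delta>))"
    using s by (simp add: matrix_vector_right_distrib matrix_vector_mult_scaleR)
  show ?thesis
    using measure_gaussian_affine[of S "sqrt s" "W r C" "W 0 C" "X *v \<beta>" "X *v ((1 / sqrt s) *\<^sub>R \<delta>)"]
      S s sets_rejection_region[OF C] rejection_region_affine[of "sqrt s" \<beta> r]
    by (simp add: eq \<beta>)
qed

text \<open>
  Adding the Lebesgue null set \<open>N\<^sup>*\<close> to the region leaves its probabilities unchanged but enlarges
  the interior, which is what the case of a vanishing covariance estimator requires.
\<close>
lemma (in equivariant_test) size_eq_1:
  assumes CC: "covariance_model CC" and Z: "concentration_space CC Z" and C: "0 < C"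
    and rank: "rank R = CARD('q)"
    and int: "AE z in lebesgue_on_subspace Z. z \<in> interior (W 0 C \<union> Ns)"
  shows "\<forall>\<mu>0\<in>null_space X R r. \<forall>s>0. (SUP S\<in>CC. measure (gaussian \<mu>0 (s *\<^sub>R S)) (W r C)) = 1"
    and "test_size X R r CC (W r C) = 1"
proof -
  note spd = covariance_modelD[OF CC]
  have le: "measure (gaussian \<mu> (s *\<^sub>R S)) E \<le> 1" if "S \<in> CC" "0 < s" for \<mu> s S E
    using prob_space.prob_le_1[OF prob_space_gaussian[OF pos_def_scaleR]] spd[OF that(1)] that(2) by blast
  have "Ns \<in> sets borel" using N_star_null by auto
  then obtain S where S: "\<And>m::nat. S m \<in> CC"
      and lim: "(\<lambda>m. measure (gaussian 0 (S m)) (W 0 C \<union> Ns)) \<longlonglongrightarrow> 1"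
    using gaussian_concentration[OF CC Z _ int tendsto_const] sets_rejection_region[OF C] by blast
  have P: "measure (gaussian \<mu> (s *\<^sub>R S m)) (W r C) = measure (gaussian 0 (S m)) (W 0 C \<union> Ns)"
    if "\<mu> \<in> null_space X R r" "0 < s" for \<mu> s m
  proof -
    from that(1) obtain \<beta> where \<beta>: "\<mu> = X *v \<beta>" "R *v \<beta> = r" by (auto simp: null_space_def)
    have "measure (gaussian \<mu> (s *\<^sub>R S m)) (W r C) = measure (gaussian 0 (S m)) (W 0 C)"
      using measure_rejection_region[OF spd[OF S[of m]] that(2) C \<beta>(2), of 0] by (simp add: \<beta>(1))
    also have "\<dots> = measure (gaussian 0 (S m)) (W 0 C \<union> Ns)"
      using sets_rejection_region[OF C] gaussian_null_sets[OF N_star_null] by (simp add: measure_Un_null_set)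
    finally show ?thesis .
  qed
  show "\<forall>\<mu>0\<in>null_space X R r. \<forall>s>0. (SUP S\<in>CC. measure (gaussian \<mu>0 (s *\<^sub>R S)) (W r C)) = 1"
    using le P S by (intro ballI allI impI cSUP_eq_of_tendsto[where k=S, OF _ _ lim]) auto
  obtain \<mu> where \<mu>: "\<mu> \<in> null_space X R r" using null_space_nonempty[OF rank] by blast
  show "test_size X R r CC (W r C) = 1"
    unfolding test_size_def using le P[OF \<mu>, of 1] S \<mu>
    by (intro cSUP_eq_of_tendsto[where k="\<lambda>m. (\<mu>, 1, S m)", OF _ _ lim]) (auto simp del: scaleR_one)
qed

lemma (in equivariant_test) rejection_probability_tendsto_0:
  assumes CC: "covariance_model CC" and Z: "concentration_space CC Z" and C: "0 < C"
    and int: "AE z in lebesgue_on_subspace Z. z \<in> interior (- W 0 C)"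
    and \<beta>: "R *v \<beta> = r" and s: "\<And>m. 0 < s m" and \<delta>: "(\<lambda>m. (1 / sqrt (s m)) *\<^sub>R \<delta> m) \<longlonglongrightarrow> 0"
  shows "\<exists>S. (\<forall>m::nat. S m \<in> CC) \<and>
    (\<lambda>m. measure (gaussian (X *v (\<beta> + \<delta> m)) (s m *\<^sub>R S m)) (W r C)) \<longlonglongrightarrow> 0"
proof -
  note spd = covariance_modelD[OF CC]
  let ?x = "\<lambda>m. X *v ((1 / sqrt (s m)) *\<^sub>R \<delta> m)"
  have "?x \<longlonglongrightarrow> X *v 0"
    using \<delta> by (intro bounded_linear.tendsto[OF matrix_vector_mul_bounded_linear])
  then have x: "?x \<longlonglongrightarrow> 0" by simp
  have W: "W 0 C \<in> sets borel" by (rule sets_rejection_region[OF C])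
  then have W': "- W 0 C \<in> sets borel" by (rule borel_comp)
  obtain S where S: "\<And>m::nat. S m \<in> CC" and lim: "(\<lambda>m. measure (gaussian (?x m) (S m)) (- W 0 C)) \<longlonglongrightarrow> 1"
    using gaussian_concentration[OF CC Z W' int x] by blast
  have "measure (gaussian (X *v (\<beta> + \<delta> m)) (s m *\<^sub>R S m)) (W r C) = 1 - measure (gaussian (?x m) (S m)) (- W 0 C)" for m
  proof -
    interpret prob_space "gaussian (?x m) (S m)" by (intro prob_space_gaussian spd S)
    have "prob (- W 0 C) = 1 - prob (W 0 C)"
      using prob_compl[of "W 0 C"] W by (simp add: Compl_eq_Diff_UNIV)
    then show ?thesis
      using measure_rejection_region[OF spd[OF S[of m]] s C \<beta>] by simp
  qed
  moreover have "(\<lambda>m. 1 - measure (gaussian (?x m) (S m)) (- W 0 C)) \<longlonglongrightarrow> 1 - 1"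
    by (intro tendsto_intros lim)
  ultimately show ?thesis by (intro exI[of _ S]) (use S in simp)
qed

text \<open>
  Three choices of parameters make \<open>\<delta> / \<surd>s\<close> tend to \<open>0\<close>: \<open>\<delta> = 0\<close> (null hypothesis), \<open>\<delta> \<rightarrow> 0\<close> with \<open>s\<close> fixed
  (alternatives approaching the null hypothesis), and \<open>s \<rightarrow> \<infinity>\<close> with \<open>\<delta>\<close> fixed (a given alternative
  drowned in noise).
\<close>
theorem (in equivariant_test) power_eq_0:
  assumes CC: "covariance_model CC" and Z: "concentration_space CC Z" and C: "0 < C"
    and rankX: "rank X = CARD('k)" and rankR: "rank R = CARD('q)"
    and int: "AE z in lebesgue_on_subspace Z. z \<in> interior (- W 0 C)"
  shows "\<forall>\<mu>0\<in>null_space X R r. \<forall>s>0. (INF S\<in>CC. measure (gaussian \<mu>0 (s *\<^sub>R S)) (W r C)) = 0"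
    and "\<forall>s>0. (INF \<mu>1\<in>alt_space X R r. INF S\<in>CC. measure (gaussian \<mu>1 (s *\<^sub>R S)) (W r C)) = 0"
    and "\<forall>\<mu>1\<in>alt_space X R r. (INF s\<in>{0<..}. INF S\<in>CC. measure (gaussian \<mu>1 (s *\<^sub>R S)) (W r C)) = 0"
    and "infimal_power X R r CC (W r C) = 0"
    and "test_size X R r CC (W r C) \<noteq> 0 \<Longrightarrow> biased_test X R r CC (W r C)"
proof -
  let ?M0 = "null_space X R r" and ?M1 = "alt_space X R r" and ?W = "W r C"
  note lim0 = rejection_probability_tendsto_0[OF CC Z C int, of _ r]
  have M1: "?M1 = {X *v \<beta> | \<beta>. R *v \<beta> \<noteq> r}"
    by (rule alt_space_eq[OF rankX])
  have surj: "surj ((*v) R)" using rankR full_rank_surjective by blast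
  obtain \<beta> where \<beta>: "R *v \<beta> = r" using surj by (metis surjD)
  obtain \<delta> where \<delta>: "R *v \<delta> \<noteq> 0" using surj by (metis surjD zero_neq_one)
  have INF_le: "(INF S\<in>CC. measure (gaussian \<mu> (s *\<^sub>R S)) ?W) \<le> measure (gaussian \<mu> (s *\<^sub>R S)) ?W"
    if "S \<in> CC" for \<mu> s S
    using that by (intro cINF_lower bdd_belowI2[where m=0]) auto
  have INF_ge: "0 \<le> (INF S\<in>CC. measure (gaussian \<mu> (s *\<^sub>R S)) ?W)" for \<mu> s
    using CC by (intro cINF_greatest) (auto simp: covariance_model_def)
  have inverse_Suc: "(\<lambda>m. (1 / real (Suc m)) *\<^sub>R v) \<longlonglongrightarrow> 0" for v :: "real^'k"
    using tendsto_scaleR[OF LIMSEQ_Suc[OF lim_1_over_n] tendsto_const[of v]] by simp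
  \<comment> \<open>Alternatives approaching the null hypothesis.\<close>
  define d where "d m = (1 / real (Suc m)) *\<^sub>R \<delta>" for m
  have alt: "X *v (\<beta> + d m) \<in> ?M1" for m
  proof -
    have "R *v (\<beta> + d m) = r + (1 / real (Suc m)) *\<^sub>R (R *v \<delta>)"
      by (simp add: \<beta> d_def matrix_vector_right_distrib matrix_vector_mult_scaleR)
    then have "R *v (\<beta> + d m) \<noteq> r" using \<delta> by simp
    then show ?thesis unfolding M1 by blast
  qed
  have near: "\<exists>S. (\<forall>m. S m \<in> CC) \<and> (\<lambda>m. measure (gaussian (X *v (\<beta> + d m)) (s *\<^sub>R S m)) ?W) \<longlonglongrightarrow> 0"
    if s: "0 < s" for s
  proof -
    have "(\<lambda>m. (1 / sqrt s) *\<^sub>R d m) \<longlonglongrightarrow> (1 / sqrt s) *\<^sub>R 0"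
      unfolding d_def by (intro tendsto_intros inverse_Suc)
    then have "(\<lambda>m. (1 / sqrt s) *\<^sub>R d m) \<longlonglongrightarrow> 0" by simp
    then show ?thesis by (rule lim0[OF \<beta> s])
  qed

  show "\<forall>\<mu>0\<in>?M0. \<forall>s>0. (INF S\<in>CC. measure (gaussian \<mu>0 (s *\<^sub>R S)) ?W) = 0"
  proof (intro ballI allI impI)
    fix \<mu>0 and s :: real assume "\<mu>0 \<in> ?M0" and s: "0 < s"
    from this(1) obtain \<beta>0 where \<beta>0: "\<mu>0 = X *v \<beta>0" "R *v \<beta>0 = r" by (auto simp: null_space_def)
    have "(\<lambda>m::nat. (1 / sqrt s) *\<^sub>R 0) \<longlonglongrightarrow> (0 :: real^'k)" by simp
    from lim0[OF \<beta>0(2) s this] obtain S where "\<And>m. S m \<in> CC"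
      "(\<lambda>m. measure (gaussian (X *v (\<beta>0 + 0)) (s *\<^sub>R S m)) ?W) \<longlonglongrightarrow> 0" by blast
    then show "(INF S\<in>CC. measure (gaussian \<mu>0 (s *\<^sub>R S)) ?W) = 0"
      by (intro cINF_eq_of_tendsto[where k=S]) (auto simp: \<beta>0(1))
  qed
  show "\<forall>s>0. (INF \<mu>1\<in>?M1. INF S\<in>CC. measure (gaussian \<mu>1 (s *\<^sub>R S)) ?W) = 0"
  proof (intro allI impI)
    fix s :: real assume "0 < s"
    with near obtain S where S: "\<And>m. S m \<in> CC"
      "(\<lambda>m. measure (gaussian (X *v (\<beta> + d m)) (s *\<^sub>R S m)) ?W) \<longlonglongrightarrow> 0" by blast
    show "(INF \<mu>1\<in>?M1. INF S\<in>CC. measure (gaussian \<mu>1 (s *\<^sub>R S)) ?W) = 0"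
      by (rule cINF_eq_of_tendsto[where k="\<lambda>m. X *v (\<beta> + d m)", OF _ _ S(2)]) (rule INF_ge alt INF_le S(1))+
  qed
  show "\<forall>\<mu>1\<in>?M1. (INF s\<in>{0<..}. INF S\<in>CC. measure (gaussian \<mu>1 (s *\<^sub>R S)) ?W) = 0"
  proof
    fix \<mu>1 assume "\<mu>1 \<in> ?M1"
    then obtain \<beta>1 where \<beta>1: "\<mu>1 = X *v \<beta>1" by (auto simp: M1)
    let ?s = "\<lambda>m. (real (Suc m))\<^sup>2"
    have s: "0 < ?s m" and sqrt: "sqrt (?s m) = real (Suc m)" for m
      by (simp_all del: of_nat_Suc)
    have "(\<lambda>m. (1 / sqrt (?s m)) *\<^sub>R (\<beta>1 - \<beta>)) \<longlonglongrightarrow> 0"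
      unfolding sqrt by (rule inverse_Suc)
    from lim0[OF \<beta> s this] obtain S where S: "\<And>m. S m \<in> CC"
      "(\<lambda>m. measure (gaussian (X *v (\<beta> + (\<beta>1 - \<beta>))) (?s m *\<^sub>R S m)) ?W) \<longlonglongrightarrow> 0" by blast
    have \<mu>1: "\<mu>1 = X *v (\<beta> + (\<beta>1 - \<beta>))" by (simp add: \<beta>1)
    show "(INF s\<in>{0<..}. INF S\<in>CC. measure (gaussian \<mu>1 (s *\<^sub>R S)) ?W) = 0"
      unfolding \<mu>1
      by (rule cINF_eq_of_tendsto[where k="?s", OF _ _ S(2)])
         (rule INF_ge greaterThan_iff[THEN iffD2] s INF_le S(1))+
  qed
  show power: "infimal_power X R r CC ?W = 0"
  proof -
    obtain S where S: "\<And>m. S m \<in> CC"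
      "(\<lambda>m. measure (gaussian (X *v (\<beta> + d m)) (1 *\<^sub>R S m)) ?W) \<longlonglongrightarrow> 0"
      using near[OF zero_less_one] by blast
    then show ?thesis
      unfolding infimal_power_def
      by (intro cINF_eq_of_tendsto[where k="\<lambda>m. (X *v (\<beta> + d m), 1, S m)", OF _ _ S(2)]) (use alt S in auto)
  qed
  have "0 \<le> test_size X R r CC ?W"
  proof -
    obtain S where S: "S \<in> CC" using CC by (auto simp: covariance_model_def)
    have "X *v \<beta> \<in> ?M0" using \<beta> by (auto simp: null_space_def)
    moreover have "bdd_above ((\<lambda>(\<mu>, s, S). measure (gaussian \<mu> (s *\<^sub>R S)) ?W) ` (?M0 \<times> {0<..} \<times> CC))"
      using CC by (intro bdd_aboveI2[where M=1])
        (auto simp: covariance_model_def intro!: prob_space.prob_le_1 prob_space_gaussian pos_def_scaleR)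
    ultimately have "measure (gaussian (X *v \<beta>) (1 *\<^sub>R S)) ?W \<le> test_size X R r CC ?W"
      unfolding test_size_def using S by (intro cSUP_upper2[where x="(X *v \<beta>, 1, S)"]) auto
    then show ?thesis using measure_nonneg order_trans by blast
  qed
  then show "test_size X R r CC ?W \<noteq> 0 \<Longrightarrow> biased_test X R r CC ?W"
    by (simp add: biased_test_def power)
qed

theorem corollary5p17:
  fixes X :: "real^'k^'n" and R :: "real^'k^'q" and r :: "real^'q"
    and CC :: "(real^'n^'n) set"
    and b :: "real^'n \<Rightarrow> real^'k" and \<Omega> :: "real^'n \<Rightarrow> real^'q^'q"
    and N Z :: "(real^'n) set" and C :: real
  assumes "CARD('k) < CARD('n)"
    and "rank X = CARD('k)"
    and "rank R = CARD('q)"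
    and "covariance_model CC"
    and "regular_equivariant_pair X b \<Omega> N"
    and "0 < C"
    and "concentration_space CC Z"
  defines "M0 \<equiv> null_space X R r" and "M1 \<equiv> alt_space X R r"
    and "T \<equiv> test_stat R r b \<Omega> N" and "W \<equiv> rejection_region R r b \<Omega> N C"
  shows
    "((\<exists>\<mu>\<in>M0. AE z in lebesgue_on_subspace Z. z \<notin> N_star \<Omega> N \<and> T (\<mu> + z) > C) \<longrightarrow>
        (\<forall>\<mu>0\<in>M0. \<forall>s>0. (SUP S\<in>CC. measure (gaussian \<mu>0 (s *\<^sub>R S)) W) = 1) \<and>
        test_size X R r CC W = 1) \<and>
     ((\<exists>\<mu>\<in>M0. AE z in lebesgue_on_subspace Z. z \<notin> N_star \<Omega> N \<and> T (\<mu> + z) < C) \<longrightarrow>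
        (\<forall>\<mu>0\<in>M0. \<forall>s>0. (INF S\<in>CC. measure (gaussian \<mu>0 (s *\<^sub>R S)) W) = 0) \<and>
        (\<forall>s>0. (INF \<mu>1\<in>M1. INF S\<in>CC. measure (gaussian \<mu>1 (s *\<^sub>R S)) W) = 0) \<and>
        (test_size X R r CC W \<noteq> 0 \<longrightarrow> biased_test X R r CC W) \<and>
        (\<forall>\<mu>1\<in>M1. (INF s\<in>{0<..}. INF S\<in>CC. measure (gaussian \<mu>1 (s *\<^sub>R S)) W) = 0) \<and>
        infimal_power X R r CC W = 0) \<and>
     ((\<forall>y. y \<notin> N \<longrightarrow> nonneg_def (\<Omega> y)) \<longrightarrow>
      (AE z in lebesgue_on_subspace Z. z \<notin> N \<and> \<Omega> z = 0 \<and> R *v b z \<noteq> 0) \<longrightarrow>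
        (\<forall>\<mu>0\<in>M0. \<forall>s>0. (SUP S\<in>CC. measure (gaussian \<mu>0 (s *\<^sub>R S)) W) = 1) \<and>
        test_size X R r CC W = 1)"
proof -
  note CC = \<open>covariance_model CC\<close> and Z = \<open>concentration_space CC Z\<close> and C = \<open>0 < C\<close>
  interpret E: equivariant_test X b \<Omega> N R by standard fact
  have T: "T (\<mu> + z) = test_stat R 0 b \<Omega> N z" if "\<mu> \<in> M0" for \<mu> z
    using that E.test_stat_affine[of 1 _ r z] by (auto simp: T_def M0_def null_space_def)
  note size_1 = E.size_eq_1[OF CC Z C \<open>rank R = CARD('q)\<close>, of r, folded M0_def W_def]
  show ?thesis
  proof (intro conjI)
    show "(\<exists>\<mu>\<in>M0. AE z in lebesgue_on_subspace Z. z \<notin> N_star \<Omega> N \<and> T (\<mu> + z) > C) \<longrightarrow>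
        (\<forall>\<mu>0\<in>M0. \<forall>s>0. (SUP S\<in>CC. measure (gaussian \<mu>0 (s *\<^sub>R S)) W) = 1) \<and>
        test_size X R r CC W = 1"
    proof (intro impI, elim bexE)
      fix \<mu> assume \<mu>: "\<mu> \<in> M0" and "AE z in lebesgue_on_subspace Z. z \<notin> N_star \<Omega> N \<and> T (\<mu> + z) > C"
      from this(2) have "AE z in lebesgue_on_subspace Z. z \<in> interior (rejection_region R 0 b \<Omega> N C \<union> N_star \<Omega> N)"
      proof eventually_elim
        case (elim z)
        then have "z \<in> interior (rejection_region R 0 b \<Omega> N C)"
          using E.interior_rejection_region[of z C] by (simp add: T[OF \<mu>])
        then show ?case
          using interior_mono[OF Un_upper1] by blast
      qed
      from size_1[OF this]
      show "(\<forall>\<mu>0\<in>M0. \<forall>s>0. (SUP S\<in>CC. measure (gaussian \<mu>0 (s *\<^sub>R S)) W) = 1) \<and> test_size X R r CC W = 1"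
        by (rule conjI)
    qed
    show "(\<forall>y. y \<notin> N \<longrightarrow> nonneg_def (\<Omega> y)) \<longrightarrow>
      (AE z in lebesgue_on_subspace Z. z \<notin> N \<and> \<Omega> z = 0 \<and> R *v b z \<noteq> 0) \<longrightarrow>
        (\<forall>\<mu>0\<in>M0. \<forall>s>0. (SUP S\<in>CC. measure (gaussian \<mu>0 (s *\<^sub>R S)) W) = 1) \<and>
        test_size X R r CC W = 1"
    proof (intro impI)
      assume nn: "\<forall>y. y \<notin> N \<longrightarrow> nonneg_def (\<Omega> y)"
        and "AE z in lebesgue_on_subspace Z. z \<notin> N \<and> \<Omega> z = 0 \<and> R *v b z \<noteq> 0"
      from this(2) have "AE z in lebesgue_on_subspace Z. z \<in> interior (rejection_region R 0 b \<Omega> N C \<union> N_star \<Omega> N)"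
        by eventually_elim (use E.interior_rejection_region_degenerate[OF C] nn in blast)
      from size_1[OF this]
      show "(\<forall>\<mu>0\<in>M0. \<forall>s>0. (SUP S\<in>CC. measure (gaussian \<mu>0 (s *\<^sub>R S)) W) = 1) \<and> test_size X R r CC W = 1"
        by (rule conjI)
    qed
    show "(\<exists>\<mu>\<in>M0. AE z in lebesgue_on_subspace Z. z \<notin> N_star \<Omega> N \<and> T (\<mu> + z) < C) \<longrightarrow>
        (\<forall>\<mu>0\<in>M0. \<forall>s>0. (INF S\<in>CC. measure (gaussian \<mu>0 (s *\<^sub>R S)) W) = 0) \<and>
        (\<forall>s>0. (INF \<mu>1\<in>M1. INF S\<in>CC. measure (gaussian \<mu>1 (s *\<^sub>R S)) W) = 0) \<and>
        (test_size X R r CC W \<noteq> 0 \<longrightarrow> biased_test X R r CC W) \<and>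
        (\<forall>\<mu>1\<in>M1. (INF s\<in>{0<..}. INF S\<in>CC. measure (gaussian \<mu>1 (s *\<^sub>R S)) W) = 0) \<and>
        infimal_power X R r CC W = 0"
    proof (intro impI, elim bexE)
      fix \<mu> assume \<mu>: "\<mu> \<in> M0" and "AE z in lebesgue_on_subspace Z. z \<notin> N_star \<Omega> N \<and> T (\<mu> + z) < C"
      from this(2) have int: "AE z in lebesgue_on_subspace Z. z \<in> interior (- rejection_region R 0 b \<Omega> N C)"
        by eventually_elim (use E.interior_acceptance_region T[OF \<mu>] in simp)
      show "(\<forall>\<mu>0\<in>M0. \<forall>s>0. (INF S\<in>CC. measure (gaussian \<mu>0 (s *\<^sub>R S)) W) = 0) \<and>
        (\<forall>s>0. (INF \<mu>1\<in>M1. INF S\<in>CC. measure (gaussian \<mu>1 (s *\<^sub>R S)) W) = 0) \<and>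
        (test_size X R r CC W \<noteq> 0 \<longrightarrow> biased_test X R r CC W) \<and>
        (\<forall>\<mu>1\<in>M1. (INF s\<in>{0<..}. INF S\<in>CC. measure (gaussian \<mu>1 (s *\<^sub>R S)) W) = 0) \<and>
        infimal_power X R r CC W = 0"
        using E.power_eq_0[OF CC Z C \<open>rank X = CARD('k)\<close> \<open>rank R = CARD('q)\<close> int, of r, folded M0_def M1_def W_def]
        by blast
    qed
  qed
qed

end
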